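(* Let $\Gamma$ be a finitely generated group. The following are equivalent. (1) Some (equivalently, every) Cayley graph $\mathrm{Cay}(\Gamma,S)$ of $\Gamma$ with respect to a finite generating set $S$ has finite strict twin-width (equivalently, finite grid number). (2) The action of $\Gamma$ on itself by right product has finite twin-width (equivalently, finite grid number); i.e. there is a total order $<$ on $\Gamma$ such that for every $g\in\Gamma$, $\mathrm{stww}(M_g^<)<\infty$ (equivalently, there is a total order $<$ on $\Gamma$ such that for every $g\in\Gamma$, $\mathrm{gn}(M_g^<)<\infty$).
   Context: Matrices: for totally ordered sets $X,Y$, an $X\times Y$ matrix is a map $M:X\times Y\to\{0,1\}$. A $k\times l$-division of $M$ is a pair $(\mathcal X,\mathcal Y)$ of partitions of $X$ and $Y$ into $k$, respectively $l$, intervals; the quotient $M/(\mathcal X,\mathcal Y)$ is the $\mathcal X\times\mathcal Y$ matrix with entry $1$ at $(X_i,Y_j)$ iff $M$ has a $1$-entry in $X_i\times Y_j$. A division sequence of a finite $M$ is a sequence of divisions starting with the division into singletons, ending with $(\{X\},\{Y\})$, each obtained from the previous one by merging two parts of $\mathcal X$ or two of $\mathcal Y$. Its width is the maximum number of $1$-entries in a row or column of a quotient matrix along the sequence. $\mathrm{stww}(M)$ is the minimum width of a division sequence; for infinite $M$ it is the supremum over finite submatrices. A $k$-grid in $M$ is a $k\times k$-division whose quotient matrix has all entries equal to $1$; the grid number $\mathrm{gn}(M)$ is the supremum of the $k$ such that $M$ has a $k$-grid. For $g\in\Gamma$ and a total order $<$ on $\Gamma$, $M_g^<$ is the $(\Gamma,<)\times(\Gamma,<)$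 matrix with $M_g^<(x,y)=1$ iff $xg=y$. Graphs: for a finite graph $G$ and a partition $\mathcal P$ of $V(G)$, $G/\mathcal P$ has vertex set $\mathcal P$, with distinct parts $X,Y$ adjacent iff some edge of $G$ joins $X$ to $Y$. A partition sequence of $G$ ($|V(G)|=n$) is a sequence $\mathcal P_n,\dots,\mathcal P_1$ of partitions of $V(G)$ from the partition into singletons to $\{V(G)\}$, each obtained from the previous one by merging two parts; its width is the maximum over $i$ of the maximum degree of $G/\mathcal P_i$. $\mathrm{stww}(G)$ is the minimum width; for infinite $G$, the supremum over finite induced subgraphs. The grid number of a graph $G$ is the minimum of $\mathrm{gn}(A_<(G))$ over all total orders $<$ on $V(G)$, where $A_<(G)$ is the adjacency matrix with rows and columns ordered by $<$. $\mathrm{Cay}(\Gamma,S)$ is the simple graph on $\Gamma$ with distinct $x,y$ adjacent iff $x^{-1}y\in S\cup S^{-1}$. *)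

theory Defs
  imports
    "HOL-Library.Disjoint_Sets"
    "HOL-Library.Extended_Nat"
    "HOL-Algebra.Generated_Groups"
begin

section \<open>Merging parts of a partition\<close>

definition singleton_parts :: "'a set \<Rightarrow> 'a set set" where
  "singleton_parts X = (\<lambda>x. {x}) ` X"

text \<open>
  The partition \<open>{X}\<close>. Parts are nonempty, so for \<open>X = {}\<close> this is the
  only partition of \<open>X\<close>, the empty one.
\<close>
definition one_part :: "'a set \<Rightarrow> 'a set set" where
  "one_part X = {X} - {{}}"

definition merges :: "'a set set \<Rightarrow> 'a set set \<Rightarrow> bool" where
  "merges P Q \<longleftrightarrow> (\<exists>A\<in>P. \<exists>B\<in>P. A \<noteq> B \<and> Q = insert (A \<union> B) (P - {A, B}))"


section \<open>Ordered 0/1-matrices\<close>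

text \<open>
  An \<open>X \<times> Y\<close> matrix is given by its index sets \<open>X\<close> and \<open>Y\<close>, (reflexive) total
  orders \<open>r\<close> and \<open>s\<close> with \<open>linear_order_on X r\<close> and \<open>linear_order_on Y s\<close>, and
  its entries \<open>M\<close>, where \<open>M x y\<close> means that the entry at \<open>(x, y)\<close> is 1.
  Only entries in \<open>X \<times> Y\<close> and the restrictions of \<open>r\<close> to \<open>X\<close> and of \<open>s\<close> to \<open>Y\<close>
  matter, so a submatrix keeps \<open>r\<close>, \<open>s\<close> and \<open>M\<close> and only shrinks \<open>X\<close> and \<open>Y\<close>.
\<close>

text \<open>Intervals need not have end points.\<close>
definition interval_on :: "'a set \<Rightarrow> 'a rel \<Rightarrow> 'a set \<Rightarrow> bool" where
  "interval_on X r I \<longleftrightarrow>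
     I \<subseteq> X \<and> (\<forall>a\<in>I. \<forall>b\<in>I. \<forall>x\<in>X. (a, x) \<in> r \<longrightarrow> (x, b) \<in> r \<longrightarrow> x \<in> I)"

definition interval_partition :: "'a set \<Rightarrow> 'a rel \<Rightarrow> 'a set set \<Rightarrow> bool" where
  "interval_partition X r P \<longleftrightarrow> partition_on X P \<and> finite P \<and> (\<forall>I\<in>P. interval_on X r I)"

definition division ::
  "'a set \<Rightarrow> 'a rel \<Rightarrow> 'b set \<Rightarrow> 'b rel \<Rightarrow> 'a set set \<times> 'b set set \<Rightarrow> bool" where
  "division X r Y s D \<longleftrightarrow> interval_partition X r (fst D) \<and> interval_partition Y s (snd D)"

definition quotient_entry :: "('a \<Rightarrow> 'b \<Rightarrow> bool) \<Rightarrow> 'a set \<Rightarrow> 'b set \<Rightarrow> bool" where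
  "quotient_entry M A B \<longleftrightarrow> (\<exists>x\<in>A. \<exists>y\<in>B. M x y)"

definition division_step ::
  "'a set set \<times> 'b set set \<Rightarrow> 'a set set \<times> 'b set set \<Rightarrow> bool" where
  "division_step D D' \<longleftrightarrow>
     (merges (fst D) (fst D') \<and> snd D' = snd D) \<or> (fst D' = fst D \<and> merges (snd D) (snd D'))"

definition division_sequence ::
  "'a set \<Rightarrow> 'a rel \<Rightarrow> 'b set \<Rightarrow> 'b rel \<Rightarrow> ('a set set \<times> 'b set set) list \<Rightarrow> bool" where
  "division_sequence X r Y s Ds \<longleftrightarrow>
     Ds \<noteq> [] \<and> (\<forall>D\<in>set Ds. division X r Y s D) \<and>
     hd Ds = (singleton_parts X, singleton_parts Y) \<and>
     last Ds = (one_part X, one_part Y) \<and>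
     successively division_step Ds"

definition division_width :: "('a \<Rightarrow> 'b \<Rightarrow> bool) \<Rightarrow> 'a set set \<times> 'b set set \<Rightarrow> enat" where
  "division_width M D =
     max (SUP A\<in>fst D. enat (card {B \<in> snd D. quotient_entry M A B}))
         (SUP B\<in>snd D. enat (card {A \<in> fst D. quotient_entry M A B}))"

text \<open>
  Only meaningful for finite \<open>X\<close> and \<open>Y\<close>. All suprema are then over finite sets,
  and the infimum is a minimum because a division sequence exists.
\<close>
definition finite_matrix_stww ::
  "'a set \<Rightarrow> 'a rel \<Rightarrow> 'b set \<Rightarrow> 'b rel \<Rightarrow> ('a \<Rightarrow> 'b \<Rightarrow> bool) \<Rightarrow> enat" where
  "finite_matrix_stww X r Y s M =
     (INF Ds\<in>{Ds. division_sequence X r Y s Ds}. SUP D\<in>set Ds. division_width M D)"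

definition matrix_stww ::
  "'a set \<Rightarrow> 'a rel \<Rightarrow> 'b set \<Rightarrow> 'b rel \<Rightarrow> ('a \<Rightarrow> 'b \<Rightarrow> bool) \<Rightarrow> enat" where
  "matrix_stww X r Y s M =
     (if finite X \<and> finite Y then finite_matrix_stww X r Y s M
      else SUP (X', Y')\<in>{(X', Y'). X' \<subseteq> X \<and> finite X' \<and> Y' \<subseteq> Y \<and> finite Y'}.
             finite_matrix_stww X' r Y' s M)"

definition has_grid ::
  "'a set \<Rightarrow> 'a rel \<Rightarrow> 'b set \<Rightarrow> 'b rel \<Rightarrow> ('a \<Rightarrow> 'b \<Rightarrow> bool) \<Rightarrow> nat \<Rightarrow> bool" where
  "has_grid X r Y s M k \<longleftrightarrow>
     (\<exists>P Q. division X r Y s (P, Q) \<and> card P = k \<and> card Q = k \<and>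
            (\<forall>A\<in>P. \<forall>B\<in>Q. quotient_entry M A B))"

definition matrix_grid_number ::
  "'a set \<Rightarrow> 'a rel \<Rightarrow> 'b set \<Rightarrow> 'b rel \<Rightarrow> ('a \<Rightarrow> 'b \<Rightarrow> bool) \<Rightarrow> enat" where
  "matrix_grid_number X r Y s M = (SUP k\<in>{k. has_grid X r Y s M k}. enat k)"


section \<open>Graphs\<close>

text \<open>
  A simple graph is given by its vertex set \<open>V\<close> and a symmetric irreflexive
  adjacency relation \<open>E\<close>, of which only the restriction to \<open>V\<close> matters.
\<close>

definition partition_sequence :: "'a set \<Rightarrow> 'a set set list \<Rightarrow> bool" where
  "partition_sequence V Ps \<longleftrightarrow>
     Ps \<noteq> [] \<and> (\<forall>P\<in>set Ps. partition_on V P) \<and>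
     hd Ps = singleton_parts V \<and> last Ps = one_part V \<and> successively merges Ps"

definition quotient_graph_adj :: "('a \<Rightarrow> 'a \<Rightarrow> bool) \<Rightarrow> 'a set \<Rightarrow> 'a set \<Rightarrow> bool" where
  "quotient_graph_adj E A B \<longleftrightarrow> A \<noteq> B \<and> (\<exists>x\<in>A. \<exists>y\<in>B. E x y)"

definition quotient_max_degree :: "('a \<Rightarrow> 'a \<Rightarrow> bool) \<Rightarrow> 'a set set \<Rightarrow> enat" where
  "quotient_max_degree E P = (SUP A\<in>P. enat (card {B \<in> P. quotient_graph_adj E A B}))"

text \<open>Only meaningful for finite \<open>V\<close>.\<close>
definition finite_graph_stww :: "'a set \<Rightarrow> ('a \<Rightarrow> 'a \<Rightarrow> bool) \<Rightarrow> enat" where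
  "finite_graph_stww V E =
     (INF Ps\<in>{Ps. partition_sequence V Ps}. SUP P\<in>set Ps. quotient_max_degree E P)"

definition graph_stww :: "'a set \<Rightarrow> ('a \<Rightarrow> 'a \<Rightarrow> bool) \<Rightarrow> enat" where
  "graph_stww V E =
     (if finite V then finite_graph_stww V E
      else SUP W\<in>{W. W \<subseteq> V \<and> finite W}. finite_graph_stww W E)"

definition graph_grid_number :: "'a set \<Rightarrow> ('a \<Rightarrow> 'a \<Rightarrow> bool) \<Rightarrow> enat" where
  "graph_grid_number V E = (INF r\<in>{r. linear_order_on V r}. matrix_grid_number V r V r E)"


section \<open>Groups\<close>

definition finite_generating_set :: "('a, 'm) monoid_scheme \<Rightarrow> 'a set \<Rightarrow> bool" where
  "finite_generating_set G S \<longleftrightarrow> finite S \<and> S \<subseteq> carrier G \<and> generate G S = carrier G"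

definition cayley_adj :: "('a, 'm) monoid_scheme \<Rightarrow> 'a set \<Rightarrow> 'a \<Rightarrow> 'a \<Rightarrow> bool" where
  "cayley_adj G S x y \<longleftrightarrow>
     x \<noteq> y \<and> inv\<^bsub>G\<^esub> x \<otimes>\<^bsub>G\<^esub> y \<in> S \<union> (\<lambda>s. inv\<^bsub>G\<^esub> s) ` S"

definition cayley_stww :: "('a, 'm) monoid_scheme \<Rightarrow> 'a set \<Rightarrow> enat" where
  "cayley_stww G S = graph_stww (carrier G) (cayley_adj G S)"

definition cayley_grid_number :: "('a, 'm) monoid_scheme \<Rightarrow> 'a set \<Rightarrow> enat" where
  "cayley_grid_number G S = graph_grid_number (carrier G) (cayley_adj G S)"

text \<open>The entries of \<open>M_g\<close>; the order only enters through the two invariants below.\<close>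
definition right_mult_matrix :: "('a, 'm) monoid_scheme \<Rightarrow> 'a \<Rightarrow> 'a \<Rightarrow> 'a \<Rightarrow> bool" where
  "right_mult_matrix G g x y \<longleftrightarrow> x \<otimes>\<^bsub>G\<^esub> g = y"

definition right_mult_stww :: "('a, 'm) monoid_scheme \<Rightarrow> 'a rel \<Rightarrow> 'a \<Rightarrow> enat" where
  "right_mult_stww G r g = matrix_stww (carrier G) r (carrier G) r (right_mult_matrix G g)"

definition right_mult_grid_number :: "('a, 'm) monoid_scheme \<Rightarrow> 'a rel \<Rightarrow> 'a \<Rightarrow> enat" where
  "right_mult_grid_number G r g =
     matrix_grid_number (carrier G) r (carrier G) r (right_mult_matrix G g)"

end

theory Submission
  imports Defs "HOL-Analysis.Function_Topology"
begin

text \<open>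
  Call a matrix sparse if every quotient of a finite submatrix has a number of 1-entries linear in
  its dimensions. By the argument of Marcus and Tardos, a matrix has finite grid number iff it is
  sparse. Sparse matrices are closed under unions, and permutation matrices that are sparse are
  closed under composition: cut the middle index set greedily into intervals that meet boundedly
  many parts on either side; sparsity bounds the number of these intervals. So for a fixed order
  all \<open>M_g\<close> are sparse iff the adjacency matrix of one (equivalently every) Cayley graph is.

  Sparsity yields bounded strict twin-width: some two consecutive parts of a division have bounded
  degree sum, and merging them increases no other degree. Conversely, in a contraction sequence
  into intervals, the first part that meets three classes of a grid contains one of them, hence
  sees the whole grid through parts that each meet few classes. A partition sequence of a finite
  graph always consists of intervals of a suitable order, and compactness provides one order for an
  infinite graph.
\<close>

section \<open>The theorem of Marcus and Tardos for grids\<close>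

text \<open>A grid in a composition does not display a grid in either factor, nor does a narrow
  division sequence for each factor combine into one for the composition. A count of 1-entries that
  is linear for every division can be added and chained, hence the detour through sparsity. Its
  constants grow with the word length of \<open>g\<close>, which is harmless because finiteness is
  asked for each \<open>g\<close> separately. For a fixed order, sparsity of all \<open>M_g\<close>
  mentions no generating set. Every clause of the theorem is compared with the existence of such an
  order, so the independence of \<open>S\<close> comes for free. For an infinite graph, finite
  twin-width only supplies an order on each finite subgraph, and these orders need not agree. What
  survives a limit is the absence of a \<open>k\<close>-grid with one \<open>k\<close> for all
  finite sets: it is inherited by subsets, and a violation is visible on a finite set. This is why
  sparsity and grids are phrased with finite submatrices and monotone labellings, which restrict to
  subsets and extend to supersets.\<close>

text \<open>The fibres of \<open>f\<close> and \<open>g\<close> are the intervals of the division.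
  Values from \<open>k\<close> on are allowed and ignored, so nothing has to be renumbered, and
  coarsening the pattern beforehand amounts to composing maps.\<close>

definition nat_grid :: "(nat \<times> nat) set \<Rightarrow> nat \<Rightarrow> bool" where
  "nat_grid E k \<longleftrightarrow> (\<exists>f g. mono f \<and> mono g \<and> {..<k} \<times> {..<k} \<subseteq> map_prod f g ` E)"

lemma nat_grid_converse:
  assumes "nat_grid (E\<inverse>) k"
  shows "nat_grid E k"
proof -
  obtain f g where fg: "mono f" "mono g" "{..<k} \<times> {..<k} \<subseteq> map_prod f g ` (E\<inverse>)"
    using assms unfolding nat_grid_def by blast
  have "{..<k} \<times> {..<k} \<subseteq> map_prod g f ` E"
  proof
    fix p assume "p \<in> {..<k} \<times> {..<k}"
    then have "prod.swap p \<in> map_prod f g ` (E\<inverse>)" using fg(3) by (cases p) auto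
    then show "p \<in> map_prod g f ` E" by (cases p) force
  qed
  then show ?thesis using fg unfolding nat_grid_def by blast
qed

text \<open>Contracting blocks to single entries creates no grid, since the labellings compose. The
  induction of Marcus and Tardos descends along this fact.\<close>

lemma nat_grid_image:
  assumes "mono f" "mono g" "nat_grid (map_prod f g ` E) k"
  shows "nat_grid E k"
proof -
  obtain f' g' where *: "mono f'" "mono g'" "{..<k} \<times> {..<k} \<subseteq> map_prod f' g' ` map_prod f g ` E"
    using assms(3) unfolding nat_grid_def by blast
  have "mono (f' \<circ> f)" "mono (g' \<circ> g)"
    using assms * by (simp_all add: mono_def)
  moreover have "{..<k} \<times> {..<k} \<subseteq> map_prod (f' \<circ> f) (g' \<circ> g) ` E"
    using *(3) by (simp add: image_comp map_prod_compose)
  ultimately show ?thesis unfolding nat_grid_def by blast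
qed

text \<open>A grid asks for labels that are monotone on all naturals, hence a rank for every point:
  outside \<open>I\<close> it is the rank of the next element of \<open>I\<close>, and
  \<open>card I\<close> beyond the last one.\<close>

definition rank_in :: "nat set \<Rightarrow> nat \<Rightarrow> nat" where
  "rank_in I x = card {i \<in> I. i < x}"

lemma mono_rank_in: "finite I \<Longrightarrow> mono (rank_in I)"
  unfolding rank_in_def by (intro monoI card_mono) auto

lemma rank_in_image:
  assumes "finite I"
  shows "rank_in I ` I = {..<card I}"
proof (rule card_subset_eq)
  have lt: "rank_in I x < rank_in I y" if "x \<in> I" "x < y" for x y
    unfolding rank_in_def using that assms by (intro psubset_card_mono) auto
  show "rank_in I ` I \<subseteq> {..<card I}"
    unfolding rank_in_def using assms by (auto intro!: psubset_card_mono)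
  have "inj_on (rank_in I) I"
    by (rule inj_onI) (metis lt less_irrefl linorder_neqE_nat)
  then show "card (rank_in I ` I) = card {..<card I}" by (simp add: card_image)
qed simp

definition block :: "nat \<Rightarrow> (nat \<times> nat) set \<Rightarrow> nat \<times> nat \<Rightarrow> (nat \<times> nat) set" where
  "block s E b = {(x, y) \<in> E. x div s = fst b \<and> y div s = snd b}"

lemma block_subset:
  assumes "s > 0"
  shows "block s E (i, j) \<subseteq> {i * s..<i * s + s} \<times> {j * s..<j * s + s}"
proof -
  have "x \<in> {x div s * s..<x div s * s + s}" for x
    using div_mult_mod_eq[of x s] mod_less_divisor[OF assms, of x]
    unfolding atLeastLessThan_iff by linarith
  then show ?thesis unfolding block_def by force
qed

text \<open>
  Otherwise, by pigeonhole, \<open>k\<close> of the blocks have ones in the same columns, which are at least \<open>k\<close>.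
\<close>
lemma card_wide_blocks:
  assumes "s > 0" "k > 0" and no: "\<not> nat_grid E k"
  shows "card {i \<in> {..<n}. k \<le> card (snd ` block s E (i, j))} \<le> k * 2 ^ s"
proof (rule ccontr)
  let ?W = "{i \<in> {..<n}. k \<le> card (snd ` block s E (i, j))}"
  let ?J = "{j * s..<j * s + s}"
  let ?S = "\<lambda>i. snd ` block s E (i, j)"
  assume "\<not> card ?W \<le> k * 2 ^ s"
  then have big: "card ?W > k * 2 ^ s" by simp
  have sub: "?S i \<subseteq> ?J" for i using block_subset[OF assms(1)] by fastforce
  have "?S \<in> ?W \<rightarrow> Pow ?J" using sub by auto
  from pigeonhole_card[OF this] obtain S where
    S: "card (?S -` {S} \<inter> ?W) * card (Pow ?J) \<ge> card ?W" by auto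
  define I where "I = ?S -` {S} \<inter> ?W"
  have pw: "card (Pow ?J) = 2 ^ s" by (simp add: card_Pow)
  have "k * 2 ^ s < card I * 2 ^ s" unfolding I_def by (rule less_le_trans[OF big S[unfolded pw]])
  then have kI: "k < card I" by (rule mult_less_cancel2[THEN iffD1, THEN conjunct2])
  have finI: "finite I" unfolding I_def by auto
  from kI obtain i0 where "i0 \<in> I" by fastforce
  then have kS: "k \<le> card S" and finS: "finite S"
    using sub[of i0] unfolding I_def by (auto intro: finite_subset)
  \<comment> \<open>Every block indexed by \<open>I\<close> has a 1-entry in every column of
    \<open>S\<close>, so ranking the blocks within \<open>I\<close> and the columns within
    \<open>S\<close> exhibits the grid.\<close>
  have "{..<k} \<times> {..<k} \<subseteq> map_prod (\<lambda>x. rank_in I (x div s)) (rank_in S) ` E"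
  proof clarify
    fix a b assume "a < k" "b < k"
    then have "a \<in> rank_in I ` I" "b \<in> rank_in S ` S"
      unfolding rank_in_image[OF finI] rank_in_image[OF finS] using kI kS by simp_all
    then obtain i c where ic: "i \<in> I" "rank_in I i = a" "c \<in> S" "rank_in S c = b"
      by blast
    then have "c \<in> ?S i" unfolding I_def by auto
    then obtain x where "(x, c) \<in> E" "x div s = i" unfolding block_def by auto
    then show "(a, b) \<in> map_prod (\<lambda>x. rank_in I (x div s)) (rank_in S) ` E" using ic by force
  qed
  moreover have "mono (\<lambda>x. rank_in I (x div s))"
    using mono_rank_in[OF finI] by (simp add: mono_def div_le_mono)
  ultimately show False using no mono_rank_in[OF finS] unfolding nat_grid_def by blast
qed

lemma block_converse: "block s (E\<inverse>) (j, i) = (block s E (i, j))\<inverse>"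
  unfolding block_def by auto

lemma card_tall_blocks:
  assumes "s > 0" "k > 0" and no: "\<not> nat_grid E k"
  shows "card {j \<in> {..<n}. k \<le> card (fst ` block s E (i, j))} \<le> k * 2 ^ s"
proof -
  have "snd ` (block s E (i, j))\<inverse> = fst ` block s E (i, j)" for i j by force
  then show ?thesis
    using card_wide_blocks[OF assms(1,2), of "E\<inverse>" n i] no nat_grid_converse[of E k]
    unfolding block_converse by auto
qed

text \<open>The recursion of Marcus and Tardos. A nonempty block that is neither wide nor tall
  occupies fewer than \<open>k\<close> rows and fewer than \<open>k\<close> columns, so it has at
  most \<open>k * k\<close> entries. The remaining blocks have up to \<open>s\<^sup>2\<close>
  entries each, but there are only linearly many of them. Taking \<open>s\<close> just above
  \<open>k * k\<close> makes the recursion contract.\<close>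

lemma card_grid_free_step:
  assumes "k > 0" and no: "\<not> nat_grid E k" and E: "E \<subseteq> {..<n} \<times> {..<n}"
    and s: "s = k * k + 1"
  defines "E' \<equiv> map_prod (\<lambda>x. x div s) (\<lambda>x. x div s) ` E"
  shows "card E \<le> k * k * card E' + 2 * k * 2 ^ s * s\<^sup>2 * (n div s + 1)"
proof -
  \<comment> \<open>The extra row and column of blocks leave room for an incomplete last
    block.\<close>
  let ?n' = "n div s + 1"
  define Wide where "Wide = (SIGMA j:{..<?n'}. {i \<in> {..<?n'}. k \<le> card (snd ` block s E (i, j))})"
  define Tall where "Tall = (SIGMA i:{..<?n'}. {j \<in> {..<?n'}. k \<le> card (fst ` block s E (i, j))})"
  \<comment> \<open>\<open>Wide\<close> lists the column block first, hence the converse.\<close>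
  define Thick where "Thick = Wide\<inverse> \<union> Tall"
  have s0: "s > 0" using s by simp
  have finE: "finite E" using E by (rule finite_subset) auto
  have E'sub: "E' \<subseteq> {..<?n'} \<times> {..<?n'}"
    using E unfolding E'_def by (fastforce simp: less_Suc_eq_le intro: div_le_mono)
  have finE': "finite E'" using finE unfolding E'_def by auto
  have "card Wide \<le> (\<Sum>j<?n'. k * 2 ^ s)" unfolding Wide_def
    by (subst card_SigmaI; (intro ballI)?)
       (simp, simp, intro sum_mono card_wide_blocks[OF s0 assms(1) no])
  moreover have "card Tall \<le> (\<Sum>j<?n'. k * 2 ^ s)" unfolding Tall_def
    by (subst card_SigmaI; (intro ballI)?)
       (simp, simp, intro sum_mono card_tall_blocks[OF s0 assms(1) no])
  moreover have finT: "finite Wide" "finite Tall" unfolding Wide_def Tall_def by auto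
  moreover have "card (Wide\<inverse>) = card Wide" by (rule card_inverse)
  ultimately have cT: "card Thick \<le> 2 * k * 2 ^ s * ?n'"
    unfolding Thick_def using card_Un_le[of "Wide\<inverse>" Tall] by (simp add: algebra_simps)
  have finThick: "finite Thick" using finT unfolding Thick_def by auto
  have any: "card (block s E b) \<le> s\<^sup>2" for b
    using card_mono[OF _ block_subset[OF s0, of E "fst b" "snd b"]]
    by (simp add: card_cartesian_product power2_eq_square)
  have thin: "card (block s E b) \<le> k * k" if "b \<in> E'" "b \<notin> Thick" for b
  proof -
    obtain i j where b: "b = (i, j)" by (cases b)
    have ij: "i < ?n'" "j < ?n'" using that(1) E'sub b by auto
    then have w: "card (snd ` block s E b) < k" and t: "card (fst ` block s E b) < k"
      using that(2) b unfolding Thick_def Wide_def Tall_def by auto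
    have "finite (block s E b)" using finE unfolding block_def by (auto intro: finite_subset)
    then have "card (block s E b) \<le> card (fst ` block s E b \<times> snd ` block s E b)"
      by (intro card_mono finite_cartesian_product finite_imageI) force+
    also have "\<dots> \<le> k * k" unfolding card_cartesian_product
      using w t by (intro mult_mono) auto
    finally show ?thesis .
  qed
  have "E = (\<Union>b\<in>E'. block s E b)" unfolding E'_def block_def by force
  then have "card E \<le> (\<Sum>b\<in>E'. card (block s E b))"
    using card_UN_le[OF finE', of "block s E"] by simp
  also have "\<dots> \<le> (\<Sum>b\<in>E'. k * k + (if b \<in> Thick then s\<^sup>2 else 0))"
    using any thin by (intro sum_mono) (auto intro: trans_le_add2)
  also have "\<dots> = k * k * card E' + s\<^sup>2 * card (E' \<inter> Thick)"
    using finE' by (simp add: sum.distrib sum.If_cases Int_def)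
  also have "\<dots> \<le> k * k * card E' + s\<^sup>2 * (2 * k * 2 ^ s * ?n')"
    using cT card_mono[OF finThick, of "E' \<inter> Thick"] by (intro add_mono mult_left_mono) auto
  finally show ?thesis by (simp add: algebra_simps)
qed

theorem Marcus_Tardos_grid:
  assumes "k > 0"
  shows "\<exists>C. \<forall>n E. E \<subseteq> {..<n} \<times> {..<n} \<longrightarrow> \<not> nat_grid E k \<longrightarrow> card E \<le> C * n"
proof -
  define p where "p = k * k"
  define s where "s = p + 1"
  define D where "D = 2 * k * 2 ^ s * s\<^sup>2"
  \<comment> \<open>The summand \<open>s * (2 * p + 1)\<close> settles small \<open>n\<close>, where
    \<open>n \<le> C\<close> makes the trivial bound \<open>n * n\<close> good enough. For larger
    \<open>n\<close> the recursion gains \<open>C * q\<close>, since \<open>s = p + 1\<close>. Half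
    of this gain pays for \<open>p * C\<close> because \<open>q \<ge> 2 * p\<close>, the other half
    for \<open>D * (q + 1)\<close> because \<open>C \<ge> 4 * D\<close>.\<close>
  define C where "C = 4 * D + s * (2 * p + 1)"
  have s2: "s \<ge> 2" using assms unfolding s_def p_def by (simp add: Suc_leI)
  have "card E \<le> C * n" if "E \<subseteq> {..<n} \<times> {..<n}" "\<not> nat_grid E k" for n E
    using that
  proof (induction n arbitrary: E rule: less_induct)
    case (less n)
    define q where "q = n div s"
    show ?case
    proof (cases "q < 2 * p + 1")
      case True
      then have "n < s * (2 * p + 1)" unfolding q_def
        using s2 by (simp add: div_less_iff_less_mult mult.commute)
      then have nC: "n \<le> C" unfolding C_def by simp
      have "card E \<le> card ({..<n} \<times> {..<n})" using less.prems(1) by (intro card_mono) auto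
      also have "\<dots> \<le> C * n" using nC by (simp add: card_cartesian_product)
      finally show ?thesis .
    next
      case False
      define E' where "E' = map_prod (\<lambda>x. x div s) (\<lambda>x. x div s) ` E"
      have qn: "s * q \<le> n" unfolding q_def by simp
      have q1: "q \<ge> 1" "q \<ge> 2 * p" using False by auto
      \<comment> \<open>The block pattern has side \<open>q + 1\<close>, which must be smaller than
        \<open>n\<close> for the induction hypothesis to apply.\<close>
      have "q + 1 < s * q"
      proof -
        have "2 * q \<le> s * q" using s2 by simp
        moreover have "p \<ge> 1" using s2 s_def by simp
        ultimately show ?thesis using False by linarith
      qed
      then have lt: "q + 1 < n" using qn by linarith
      have sub: "E' \<subseteq> {..<q + 1} \<times> {..<q + 1}"
        using less.prems(1) unfolding E'_def q_def
        by (fastforce simp: less_Suc_eq_le intro: div_le_mono)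
      have "mono (\<lambda>x::nat. x div s)" by (simp add: mono_def div_le_mono)
      then have "\<not> nat_grid E' k" unfolding E'_def
        using nat_grid_image less.prems(2) by blast
      then have IH: "card E' \<le> C * (q + 1)" using less.IH[OF lt sub] by simp
      have "card E \<le> p * card E' + D * (q + 1)"
        using card_grid_free_step[OF assms less.prems(2,1), of s]
        unfolding E'_def D_def q_def s_def p_def by simp
      also have "\<dots> \<le> p * (C * (q + 1)) + D * (q + 1)" using IH by simp
      also have "\<dots> \<le> C * (s * q)"
      proof -
        have "C * (2 * p) \<le> C * q" using q1 by (intro mult_left_mono) auto
        moreover have "4 * D * q \<le> C * q" unfolding C_def by (simp add: algebra_simps)
        moreover have "D * 1 \<le> D * q" using q1 by (intro mult_left_mono) auto
        moreover have "2 * (p * C) + 2 * (D * (q + 1)) = C * (2 * p) + 2 * (D * q) + 2 * (D * 1)"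
          "4 * D * q = 4 * (D * q)"
          by (simp_all add: algebra_simps)
        ultimately have "2 * (p * C) + 2 * (D * (q + 1)) \<le> 2 * (C * q)" by linarith
        then show ?thesis unfolding s_def by (simp add: algebra_simps)
      qed
      also have "\<dots> \<le> C * n" using qn by simp
      finally show ?thesis .
    qed
  qed
  then show ?thesis by blast
qed

section \<open>Sparse matrices and the grid number\<close>

lemma linear_order_onD:
  assumes "linear_order_on X r"
  shows "\<And>x. x \<in> X \<Longrightarrow> (x, x) \<in> r"
    and "\<And>x y. x \<in> X \<Longrightarrow> y \<in> X \<Longrightarrow> (x, y) \<in> r \<or> (y, x) \<in> r"
    and "\<And>x y z. (x, y) \<in> r \<Longrightarrow> (y, z) \<in> r \<Longrightarrow> (x, z) \<in> r"
    and "\<And>x y. (x, y) \<in> r \<Longrightarrow> (y, x) \<in> r \<Longrightarrow> x = y"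
proof -
  have r: "refl_on X r" "total_on X r" "trans r" "antisym r"
    using assms unfolding order_on_defs by auto
  show refl: "(x, x) \<in> r" if "x \<in> X" for x using r(1) that by (rule refl_onD)
  show "(x, y) \<in> r \<or> (y, x) \<in> r" if "x \<in> X" "y \<in> X" for x y
    using r(2) refl that unfolding total_on_def by (cases "x = y") auto
  show "(x, z) \<in> r" if "(x, y) \<in> r" "(y, z) \<in> r" for x y z using r(3) that by (rule transD)
  show "x = y" if "(x, y) \<in> r" "(y, x) \<in> r" for x y using r(4) that by (rule antisymD)
qed

abbreviation index_map :: "'a set \<Rightarrow> 'a rel \<Rightarrow> ('a \<Rightarrow> nat) \<Rightarrow> bool" where
  "index_map X r f \<equiv> monotone_on X (\<lambda>x y. (x, y) \<in> r) (\<le>) f"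

text \<open>A new point takes the largest label among the points of \<open>W\<close> below it. The
  default label 0 serves the points that have none below; it is in range because
  \<open>m > 0\<close>.\<close>

lemma index_map_extend:
  assumes lin: "linear_order_on X r" and W: "finite W" "W \<subseteq> X"
    and f: "index_map W r f" "f ` W \<subseteq> {..<m}" "m > 0"
  obtains f' where "index_map X r f'" "\<And>x. x \<in> W \<Longrightarrow> f' x = f x" "f' ` X \<subseteq> {..<m}"
proof
  note r = linear_order_onD[OF lin]
  define L where "L x = insert 0 (f ` {w \<in> W. (w, x) \<in> r})" for x
  have fin: "finite (L x)" for x using W unfolding L_def by simp
  have ne: "L x \<noteq> {}" for x unfolding L_def by simp
  show "index_map X r (\<lambda>x. Max (L x))"
  proof (rule monotone_onI)
    fix x y assume "(x, y) \<in> r"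
    then have "L x \<subseteq> L y" unfolding L_def using r(3) by blast
    then show "Max (L x) \<le> Max (L y)" by (rule Max_mono[OF _ ne fin])
  qed
  show "Max (L x) = f x" if "x \<in> W" for x
  proof (rule Max_eqI[OF fin])
    show "y \<le> f x" if "y \<in> L x" for y
      using that \<open>x \<in> W\<close> f(1) unfolding L_def by (auto dest: monotone_onD)
    show "f x \<in> L x" unfolding L_def using that W r(1) by auto
  qed
  have "Max (L x) \<in> L x" for x using Max_in[OF fin ne] .
  moreover have "L x \<subseteq> {..<m}" for x unfolding L_def using f by auto
  ultimately show "(\<lambda>x. Max (L x)) ` X \<subseteq> {..<m}" by blast
qed

text \<open>The map sends a point to the number of parts that precede its own.\<close>
lemma interval_partition_index_map:
  assumes lin: "linear_order_on X r" and WX: "W \<subseteq> X" and P: "interval_partition W r P"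
  obtains f where "index_map W r f" "f ` W = {..<card P}"
    "P = (\<lambda>i. {x \<in> W. f x = i}) ` {..<card P}"
proof -
  note r = linear_order_onD[OF lin]
  have part: "\<Union>P = W" "disjoint P" "{} \<notin> P" and finP: "finite P"
    and int: "\<And>I. I \<in> P \<Longrightarrow> interval_on W r I"
    using P unfolding interval_partition_def partition_on_def by auto
  have disj: "A = B" if "A \<in> P" "B \<in> P" "x \<in> A" "x \<in> B" for A B x
    using part(2) that by (auto dest: disjointD)
  define rep where "rep A = (SOME a. a \<in> A)" for A :: "'a set"
  have rep: "rep A \<in> A" if "A \<in> P" for A
    using that part(3) unfolding rep_def by (metis some_in_eq)
  have inX: "x \<in> X" if "x \<in> A" "A \<in> P" for x A using that part(1) WX by auto
  have repX: "rep A \<in> X" if "A \<in> P" for A using inX[OF rep] that by simp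
  have sandwich: "x \<in> A" if "A \<in> P" "B \<in> P" "a \<in> A" "b \<in> A" "x \<in> B" "(a, x) \<in> r" "(x, b) \<in> r"
    for A B a b x
    using int[OF that(1)] that part(1) unfolding interval_on_def by blast
  define prec where "prec A B \<longleftrightarrow> A \<noteq> B \<and> (rep A, rep B) \<in> r" for A B
  define idx where "idx A = card {B \<in> P. prec B A}" for A
  \<comment> \<open>Although \<open>prec\<close> compares only chosen representatives, any two
    points of the parts decide it: if the representatives were ordered the other way, convexity
    would put \<open>rep B\<close> into \<open>A\<close> or \<open>a\<close> into
    \<open>B\<close>.\<close>
  have precI: "prec A B" if "A \<in> P" "B \<in> P" "A \<noteq> B" "a \<in> A" "b \<in> B" "(a, b) \<in> r" for A B a b
  proof (rule ccontr)
    assume "\<not> prec A B"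
    then have BA: "(rep B, rep A) \<in> r"
      using that(3) r(2)[OF repX[OF that(1)] repX[OF that(2)]] unfolding prec_def by blast
    have "(a, rep B) \<in> r \<or> (rep B, a) \<in> r"
      using r(2)[OF inX[OF that(4,1)] repX[OF that(2)]] .
    then show False
    proof
      assume 1: "(a, rep B) \<in> r"
      have "rep B \<in> A" using sandwich[OF that(1,2,4) rep[OF that(1)] rep[OF that(2)] 1 BA] .
      then show False using disj[OF that(1,2) _ rep[OF that(2)]] that(3) by simp
    next
      assume "(rep B, a) \<in> r"
      then have "a \<in> B" using sandwich[OF that(2,1) rep[OF that(2)] that(5,4)] that(6) by simp
      then show False using disj[OF that(1,2,4)] that(3) by simp
    qed
  qed
  have idx_less: "idx A < idx B" if "A \<in> P" "B \<in> P" "prec A B" for A B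
  proof -
    have "prec C B" if "C \<in> P" "prec C A" for C
    proof -
      have "(rep C, rep B) \<in> r" using that \<open>prec A B\<close> r(3) unfolding prec_def by blast
      moreover have "C \<noteq> B"
      proof
        assume "C = B"
        then have "rep A = rep B" using that \<open>prec A B\<close> r(4) unfolding prec_def by blast
        then show False using \<open>prec A B\<close> rep disj \<open>A \<in> P\<close> \<open>B \<in> P\<close> unfolding prec_def by metis
      qed
      ultimately show ?thesis unfolding prec_def by blast
    qed
    moreover have "\<not> prec A A" unfolding prec_def by simp
    ultimately show ?thesis unfolding idx_def using finP that
      by (intro psubset_card_mono) auto
  qed
  have idx_inj: "A = B" if "A \<in> P" "B \<in> P" "idx A = idx B" for A B
  proof (rule ccontr)
    assume "A \<noteq> B"
    moreover have "(rep A, rep B) \<in> r \<or> (rep B, rep A) \<in> r"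
      using r(2) repX that by simp
    ultimately have "prec A B \<or> prec B A" unfolding prec_def by blast
    then show False using idx_less[of A B] idx_less[of B A] that by auto
  qed
  have idx_lt: "idx A < card P" if "A \<in> P" for A
    unfolding idx_def using finP that by (intro psubset_card_mono) (auto simp: prec_def)
  have idx_img: "idx ` P = {..<card P}"
  proof (rule card_subset_eq)
    show "idx ` P \<subseteq> {..<card P}" using idx_lt by auto
    have "inj_on idx P" using idx_inj by (intro inj_onI) blast
    then show "card (idx ` P) = card {..<card P}" by (simp add: card_image)
  qed simp
  define pt where "pt x = (THE A. A \<in> P \<and> x \<in> A)" for x
  have pt: "pt x = A" if "A \<in> P" "x \<in> A" for A x
    unfolding pt_def using that disj by (intro the_equality) auto
  define f where "f x = idx (pt x)" for x
  have fx: "f x = idx A" if "A \<in> P" "x \<in> A" for A x unfolding f_def using pt[OF that] by simp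
  show thesis
  proof
    show "index_map W r f"
    proof (rule monotone_onI)
      fix x y assume xy: "x \<in> W" "y \<in> W" "(x, y) \<in> r"
      then obtain A B where AB: "A \<in> P" "x \<in> A" "B \<in> P" "y \<in> B" using part(1) by auto
      show "f x \<le> f y"
      proof (cases "A = B")
        case True then show ?thesis using fx AB by simp
      next
        case False
        then have "idx A < idx B" using precI idx_less AB xy by blast
        then show ?thesis using fx AB by simp
      qed
    qed
    have fib: "A = {x \<in> W. f x = idx A}" if "A \<in> P" for A
    proof
      show "A \<subseteq> {x \<in> W. f x = idx A}" using fx that part(1) by auto
      show "{x \<in> W. f x = idx A} \<subseteq> A"
      proof
        fix x assume x: "x \<in> {x \<in> W. f x = idx A}"
        then obtain B where B: "B \<in> P" "x \<in> B" using part(1) by auto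
        then have "idx B = idx A" using fx x by simp
        then show "x \<in> A" using idx_inj that B by blast
      qed
    qed
    have "f ` W = idx ` P"
    proof
      show "f ` W \<subseteq> idx ` P" using fx part(1) by auto
      show "idx ` P \<subseteq> f ` W"
      proof
        fix i assume "i \<in> idx ` P"
        then obtain A where A: "A \<in> P" "i = idx A" by blast
        then have "i = f (rep A)" "rep A \<in> W" using fx rep part(1) by auto
        then show "i \<in> f ` W" by blast
      qed
    qed
    then show "f ` W = {..<card P}" using idx_img by simp
    show "P = (\<lambda>i. {x \<in> W. f x = i}) ` {..<card P}"
      unfolding idx_img[symmetric] image_image using fib by simp
  qed
qed

lemma index_map_interval:
  assumes "index_map X r f" "\<And>i j k. i \<in> N \<Longrightarrow> k \<in> N \<Longrightarrow> i \<le> j \<Longrightarrow> j \<le> k \<Longrightarrow> j \<in> N"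
  shows "interval_on X r {x \<in> X. f x \<in> N}"
  unfolding interval_on_def using assms(2) by (blast intro: monotone_onD[OF assms(1)])

lemma card_index_fibres: "card ((\<lambda>i. {x \<in> X. f x = i}) ` f ` X) = card (f ` X)"
  by (rule card_image) (auto simp: inj_on_def)

lemma index_map_interval_partition:
  assumes "index_map X r f" "finite (f ` X)"
  shows "interval_partition X r ((\<lambda>i. {x \<in> X. f x = i}) ` f ` X)"
  unfolding interval_partition_def partition_on_def disjoint_def
  using assms(2) index_map_interval[OF assms(1), of "{i}" for i] by auto

section \<open>Sparsity against grids in finite submatrices\<close>

definition index_ones ::
  "('a \<Rightarrow> 'b \<Rightarrow> bool) \<Rightarrow> ('a \<Rightarrow> nat) \<Rightarrow> ('b \<Rightarrow> nat) \<Rightarrow> 'a set \<Rightarrow> 'b set \<Rightarrow> (nat \<times> nat) set" where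
  "index_ones M f g A B = {(f x, g y) |x y. x \<in> A \<and> y \<in> B \<and> M x y}"

lemma finite_index_ones: "finite A \<Longrightarrow> finite B \<Longrightarrow> finite (index_ones M f g A B)"
  by (rule finite_subset[of _ "f ` A \<times> g ` B"]) (auto simp: index_ones_def)

text \<open>
  A monotone map into \<open>{..<m}\<close> stands for a division into at most \<open>m\<close> intervals, and
  \<open>index_ones\<close> for the 1-entries of the quotient matrix.
\<close>
definition sparse :: "'a set \<Rightarrow> 'a rel \<Rightarrow> ('a \<Rightarrow> 'a \<Rightarrow> bool) \<Rightarrow> nat \<Rightarrow> bool" where
  "sparse X r M c \<longleftrightarrow>
     (\<forall>A B f g m n. finite A \<longrightarrow> finite B \<longrightarrow> A \<subseteq> X \<longrightarrow> B \<subseteq> X \<longrightarrow>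
        index_map A r f \<longrightarrow> index_map B r g \<longrightarrow> f ` A \<subseteq> {..<m} \<longrightarrow> g ` B \<subseteq> {..<n} \<longrightarrow>
        card (index_ones M f g A B) \<le> c * (m + n))"

lemma sparseD:
  assumes "sparse X r M c" "finite A" "finite B" "A \<subseteq> X" "B \<subseteq> X" "index_map A r f" "index_map B r g"
    "f ` A \<subseteq> {..<m}" "g ` B \<subseteq> {..<n}"
  shows "card (index_ones M f g A B) \<le> c * (m + n)"
  using assms unfolding sparse_def by simp

text \<open>In contrast to \<open>has_grid\<close>, the witnesses are finite and labels from
  \<open>k\<close> on may occur. Grid-freeness in this sense passes to subsets and is decided on
  finite sets.\<close>

definition index_grid :: "'a set \<Rightarrow> 'a rel \<Rightarrow> ('a \<Rightarrow> 'a \<Rightarrow> bool) \<Rightarrow> nat \<Rightarrow> bool" where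
  "index_grid X r M k \<longleftrightarrow>
     (\<exists>A B f g. finite A \<and> finite B \<and> A \<subseteq> X \<and> B \<subseteq> X \<and> index_map A r f \<and> index_map B r g \<and>
        {..<k} \<times> {..<k} \<subseteq> index_ones M f g A B)"

text \<open>Extending the labellings to all of \<open>X\<close> yields a grid on every
  \<open>W\<close> that contains the finitely many witnesses. It is needed both for \<open>X\<close>
  itself and for finite \<open>W\<close>, where rows and columns share one index set and every class
  is attained.\<close>

lemma index_grid_total:
  assumes lin: "linear_order_on X r" and grid: "index_grid X r M k" and k: "k > 0"
  obtains W0 where "finite W0" "W0 \<subseteq> X"
    "\<And>W. W0 \<subseteq> W \<Longrightarrow> W \<subseteq> X \<Longrightarrow> \<exists>f g. index_map W r f \<and> index_map W r g \<and>
       f ` W = {..<k} \<and> g ` W = {..<k} \<and> {..<k} \<times> {..<k} \<subseteq> index_ones M f g W W"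
proof -
  obtain A B f g where AB: "finite A" "finite B" "A \<subseteq> X" "B \<subseteq> X" "index_map A r f" "index_map B r g"
    and ones: "{..<k} \<times> {..<k} \<subseteq> index_ones M f g A B"
    using grid unfolding index_grid_def by blast
  have cap: "index_map C r (\<lambda>x. min (k - 1) (h x))" if "index_map C r h" for C h
    using that by (auto simp: monotone_on_def min_le_iff_disj)
  have rng: "(\<lambda>x. min (k - 1) (h x)) ` C \<subseteq> {..<k}" for h :: "'a \<Rightarrow> nat" and C using k by auto
  obtain f' where f': "index_map X r f'" "\<And>x. x \<in> A \<Longrightarrow> f' x = min (k - 1) (f x)" "f' ` X \<subseteq> {..<k}"
    using index_map_extend[OF lin AB(1,3) cap[OF AB(5)] rng k] by blast
  obtain g' where g': "index_map X r g'" "\<And>x. x \<in> B \<Longrightarrow> g' x = min (k - 1) (g x)" "g' ` X \<subseteq> {..<k}"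
    using index_map_extend[OF lin AB(2,4) cap[OF AB(6)] rng k] by blast
  have entry: "\<exists>x\<in>A. \<exists>y\<in>B. f' x = i \<and> g' y = j \<and> M x y" if "i < k" "j < k" for i j
  proof -
    have "(i, j) \<in> index_ones M f g A B" using ones that by auto
    then obtain x y where "x \<in> A" "y \<in> B" "M x y" "f x = i" "g y = j" unfolding index_ones_def by auto
    then show ?thesis using that f'(2) g'(2) by (intro bexI[of _ x] bexI[of _ y]) auto
  qed
  show thesis
  proof (rule that)
    show "finite (A \<union> B)" "A \<union> B \<subseteq> X" using AB by auto
    fix W assume W: "A \<union> B \<subseteq> W" "W \<subseteq> X"
    have "f' ` W = {..<k}" "g' ` W = {..<k}"
    proof -
      have "f' ` W \<subseteq> {..<k}" "g' ` W \<subseteq> {..<k}" using f'(3) g'(3) W(2) by blast+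
      moreover have "i \<in> f' ` W" if "i < k" for i
        using entry[OF that k] W(1) by auto
      moreover have "i \<in> g' ` W" if "i < k" for i
        using entry[OF k that] W(1) by auto
      ultimately show "f' ` W = {..<k}" "g' ` W = {..<k}" by auto
    qed
    moreover have "{..<k} \<times> {..<k} \<subseteq> index_ones M f' g' W W"
    proof clarify
      fix i j assume "i < k" "j < k"
      then obtain x y where "x \<in> A" "y \<in> B" "f' x = i" "g' y = j" "M x y" using entry by blast
      then show "(i, j) \<in> index_ones M f' g' W W" using W(1) unfolding index_ones_def by blast
    qed
    moreover have "index_map W r f'" "index_map W r g'"
      using monotone_on_subset[OF f'(1) W(2)] monotone_on_subset[OF g'(1) W(2)] .
    ultimately show "\<exists>f g. index_map W r f \<and> index_map W r g \<and>
       f ` W = {..<k} \<and> g ` W = {..<k} \<and> {..<k} \<times> {..<k} \<subseteq> index_ones M f g W W"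
      by blast
  qed
qed

lemma index_grid_onto:
  assumes "linear_order_on X r" "index_grid X r M k" "k > 0"
  obtains f g where "index_map X r f" "f ` X = {..<k}" "index_map X r g" "g ` X = {..<k}"
    "{..<k} \<times> {..<k} \<subseteq> index_ones M f g X X"
proof (rule index_grid_total[OF assms])
  fix W0
  assume "W0 \<subseteq> X" and *: "\<And>W. W0 \<subseteq> W \<Longrightarrow> W \<subseteq> X \<Longrightarrow> \<exists>f g. index_map W r f \<and> index_map W r g \<and>
       f ` W = {..<k} \<and> g ` W = {..<k} \<and> {..<k} \<times> {..<k} \<subseteq> index_ones M f g W W"
  from *[OF this(1) order_refl] show thesis using that by blast
qed

lemma index_grid_has_grid:
  assumes lin: "linear_order_on X r" and grid: "index_grid X r M k" and k: "k > 0"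
  shows "has_grid X r X r M k"
proof -
  obtain f g where f: "index_map X r f" "f ` X = {..<k}" and g: "index_map X r g" "g ` X = {..<k}"
    and ones: "{..<k} \<times> {..<k} \<subseteq> index_ones M f g X X"
    by (rule index_grid_onto[OF assms])
  define P where "P = (\<lambda>i. {x \<in> X. f x = i}) ` f ` X"
  define Q where "Q = (\<lambda>i. {x \<in> X. g x = i}) ` g ` X"
  have "quotient_entry M A B" if "A \<in> P" "B \<in> Q" for A B
  proof -
    obtain i j where ij: "i < k" "j < k" "A = {x \<in> X. f x = i}" "B = {x \<in> X. g x = j}"
      using \<open>A \<in> P\<close> \<open>B \<in> Q\<close> unfolding P_def Q_def f(2) g(2) by auto
    then have "(i, j) \<in> index_ones M f g X X" using ones by auto
    then show ?thesis unfolding index_ones_def quotient_entry_def ij by blast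
  qed
  moreover have "card P = k" "card Q = k"
    unfolding P_def Q_def card_index_fibres using f(2) g(2) by simp_all
  moreover have "division X r X r (P, Q)"
    unfolding division_def P_def Q_def
    using index_map_interval_partition[OF f(1)] index_map_interval_partition[OF g(1)] f(2) g(2) by simp
  ultimately show ?thesis unfolding has_grid_def by blast
qed

text \<open>One 1-entry chosen in each of the \<open>k * k\<close> cells gives finite index sets
  that still carry the grid.\<close>

lemma has_grid_index_grid:
  assumes lin: "linear_order_on X r" and grid: "has_grid X r X r M k"
  shows "index_grid X r M k"
proof -
  obtain P Q where PQ: "interval_partition X r P" "interval_partition X r Q" "card P = k" "card Q = k"
    and all: "\<And>A B. A \<in> P \<Longrightarrow> B \<in> Q \<Longrightarrow> quotient_entry M A B"
    using grid unfolding has_grid_def division_def by auto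
  obtain f where f: "index_map X r f" "P = (\<lambda>i. {x \<in> X. f x = i}) ` {..<k}"
    by (rule interval_partition_index_map[OF lin order_refl PQ(1), unfolded PQ(3)])
  obtain g where g: "index_map X r g" "Q = (\<lambda>i. {x \<in> X. g x = i}) ` {..<k}"
    by (rule interval_partition_index_map[OF lin order_refl PQ(2), unfolded PQ(4)])
  have "\<exists>x\<in>X. \<exists>y\<in>X. f x = i \<and> g y = j \<and> M x y" if "i < k" "j < k" for i j
  proof -
    have "{x \<in> X. f x = i} \<in> P" "{x \<in> X. g x = j} \<in> Q" unfolding f(2) g(2) using that by auto
    from all[OF this] show ?thesis unfolding quotient_entry_def by blast
  qed
  then have "\<forall>p\<in>{..<k} \<times> {..<k}. \<exists>q. fst q \<in> X \<and> snd q \<in> X \<and>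
      f (fst q) = fst p \<and> g (snd q) = snd p \<and> M (fst q) (snd q)"
    by fastforce
  then obtain w where w: "\<forall>p\<in>{..<k} \<times> {..<k}. fst (w p) \<in> X \<and> snd (w p) \<in> X \<and>
      f (fst (w p)) = fst p \<and> g (snd (w p)) = snd p \<and> M (fst (w p)) (snd (w p))"
    by (rule bchoice[THEN exE])
  let ?K = "{..<k} \<times> {..<k}"
  let ?A = "(\<lambda>p. fst (w p)) ` ?K" and ?B = "(\<lambda>p. snd (w p)) ` ?K"
  have sub: "?A \<subseteq> X" "?B \<subseteq> X" using w by auto
  have "?K \<subseteq> index_ones M f g ?A ?B"
  proof
    fix p assume p: "p \<in> ?K"
    then have "(f (fst (w p)), g (snd (w p))) \<in> index_ones M f g ?A ?B"
      unfolding index_ones_def using bspec[OF w p] p by blast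
    then show "p \<in> index_ones M f g ?A ?B" using bspec[OF w p] by simp
  qed
  then show ?thesis unfolding index_grid_def
    using sub monotone_on_subset[OF f(1) sub(1)] monotone_on_subset[OF g(1) sub(2)]
    by (intro exI[of _ ?A] exI[of _ ?B] exI[of _ f] exI[of _ g]) auto
qed

text \<open>After discarding the labels from \<open>k\<close> on, all \<open>k * k\<close> cells are
  1-entries, while sparsity admits at most \<open>c * (k + k)\<close>.\<close>

lemma sparse_index_grid_bound:
  assumes "sparse X r M c" "index_grid X r M k"
  shows "k \<le> 2 * c"
proof -
  obtain A B f g where AB: "finite A" "finite B" "A \<subseteq> X" "B \<subseteq> X" "index_map A r f" "index_map B r g"
    and ones: "{..<k} \<times> {..<k} \<subseteq> index_ones M f g A B"
    using assms(2) unfolding index_grid_def by blast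
  define A' where "A' = {x \<in> A. f x < k}"
  define B' where "B' = {x \<in> B. g x < k}"
  have sub: "A' \<subseteq> A" "B' \<subseteq> B" and fin: "finite A'" "finite B'"
    unfolding A'_def B'_def using AB by auto
  have "index_map A' r f" "index_map B' r g"
    using AB sub by (auto intro: monotone_on_subset)
  moreover have "f ` A' \<subseteq> {..<k}" "g ` B' \<subseteq> {..<k}" unfolding A'_def B'_def by auto
  moreover have "A' \<subseteq> X" "B' \<subseteq> X" using sub AB by auto
  ultimately have "card (index_ones M f g A' B') \<le> c * (k + k)"
    using fin by (intro sparseD[OF assms(1)])
  moreover have "{..<k} \<times> {..<k} \<subseteq> index_ones M f g A' B'"
    using ones unfolding index_ones_def A'_def B'_def by blast
  then have "card ({..<k} \<times> {..<k}) \<le> card (index_ones M f g A' B')"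
    by (intro card_mono finite_index_ones fin)
  ultimately have "k * k \<le> c * (k + k)" by (simp add: card_cartesian_product)
  moreover have "c * (k + k) = 2 * c * k" by simp
  ultimately have "k * k \<le> 2 * c * k" by (simp only:)
  then show ?thesis unfolding mult_le_cancel2 by auto
qed

text \<open>A grid among the 1-entries of a quotient pulls back to the matrix by composing
  labellings, so the theorem of Marcus and Tardos applies to every quotient with one constant. An
  \<open>m\<close> by \<open>n\<close> pattern is placed in the square of side \<open>m + n\<close>,
  whence the form of the bound in \<open>sparse\<close>.\<close>

lemma index_grid_free_sparse:
  assumes "k > 0" "\<not> index_grid X r M k"
  shows "\<exists>c. sparse X r M c"
proof -
  obtain C where C: "\<And>n E. E \<subseteq> {..<n} \<times> {..<n} \<Longrightarrow> \<not> nat_grid E k \<Longrightarrow> card E \<le> C * n"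
    using Marcus_Tardos_grid[OF assms(1)] by blast
  have "sparse X r M C" unfolding sparse_def
  proof (intro allI impI)
    fix A B f g m n
    assume AB: "finite A" "finite B" "A \<subseteq> X" "B \<subseteq> X" "index_map A r f" "index_map B r g"
      and rng: "f ` A \<subseteq> {..<m}" "g ` B \<subseteq> {..<n}"
    have "\<not> nat_grid (index_ones M f g A B) k"
    proof
      assume "nat_grid (index_ones M f g A B) k"
      then obtain f' g' where fg: "mono f'" "mono g'"
        "{..<k} \<times> {..<k} \<subseteq> map_prod f' g' ` index_ones M f g A B"
        unfolding nat_grid_def by blast
      have "map_prod f' g' ` index_ones M f g A B = index_ones M (f' \<circ> f) (g' \<circ> g) A B"
        unfolding index_ones_def by force
      moreover have "index_map A r (f' \<circ> f)" "index_map B r (g' \<circ> g)"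
        using AB fg by (auto simp: monotone_on_def mono_def)
      ultimately show False using assms(2) AB fg(3) unfolding index_grid_def by metis
    qed
    moreover have "index_ones M f g A B \<subseteq> {..<m + n} \<times> {..<m + n}"
      using rng unfolding index_ones_def by fastforce
    ultimately show "card (index_ones M f g A B) \<le> C * (m + n)" using C by blast
  qed
  then show ?thesis by blast
qed

theorem grid_number_finite_iff_sparse:
  assumes lin: "linear_order_on X r"
  shows "matrix_grid_number X r X r M < \<infinity> \<longleftrightarrow> (\<exists>c. sparse X r M c)"
proof
  assume "matrix_grid_number X r X r M < \<infinity>"
  then obtain K where K: "matrix_grid_number X r X r M = enat K" by auto
  have "\<not> has_grid X r X r M (Suc K)"
  proof
    assume "has_grid X r X r M (Suc K)"
    then have "enat (Suc K) \<le> enat K" unfolding K[symmetric] matrix_grid_number_def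
      by (intro SUP_upper) simp
    then show False by simp
  qed
  then have "\<not> index_grid X r M (Suc K)" using index_grid_has_grid[OF lin] by blast
  then show "\<exists>c. sparse X r M c" using index_grid_free_sparse by blast
next
  assume "\<exists>c. sparse X r M c"
  then obtain c where c: "sparse X r M c" ..
  have "matrix_grid_number X r X r M \<le> enat (2 * c)" unfolding matrix_grid_number_def
    using sparse_index_grid_bound[OF c] has_grid_index_grid[OF lin] by (auto intro!: SUP_least)
  then show "matrix_grid_number X r X r M < \<infinity>" by (rule le_less_trans) simp
qed

section \<open>Unions and compositions of sparse matrices\<close>

lemma sparse_mono:
  assumes "sparse X r N c" "\<And>x y. x \<in> X \<Longrightarrow> y \<in> X \<Longrightarrow> M x y \<Longrightarrow> N x y"
  shows "sparse X r M c"
  unfolding sparse_def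
proof (intro allI impI)
  fix A B f g m n
  assume *: "finite A" "finite B" "A \<subseteq> X" "B \<subseteq> X" "index_map A r f" "index_map B r g"
    "f ` A \<subseteq> {..<m}" "g ` B \<subseteq> {..<n}"
  have "index_ones M f g A B \<subseteq> index_ones N f g A B"
    using assms(2) *(3,4) unfolding index_ones_def by blast
  then have "card (index_ones M f g A B) \<le> card (index_ones N f g A B)"
    by (intro card_mono finite_index_ones *)
  also have "\<dots> \<le> c * (m + n)" by (intro sparseD[OF assms(1)] *)
  finally show "card (index_ones M f g A B) \<le> c * (m + n)" .
qed

lemma sparse_disj:
  assumes "sparse X r M c" "sparse X r N d"
  shows "sparse X r (\<lambda>x y. M x y \<or> N x y) (c + d)"
  unfolding sparse_def
proof (intro allI impI)
  fix A B f g m n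
  assume *: "finite A" "finite B" "A \<subseteq> X" "B \<subseteq> X" "index_map A r f" "index_map B r g"
    "f ` A \<subseteq> {..<m}" "g ` B \<subseteq> {..<n}"
  have "index_ones (\<lambda>x y. M x y \<or> N x y) f g A B = index_ones M f g A B \<union> index_ones N f g A B"
    unfolding index_ones_def by blast
  then have "card (index_ones (\<lambda>x y. M x y \<or> N x y) f g A B)
      \<le> card (index_ones M f g A B) + card (index_ones N f g A B)"
    by (simp add: card_Un_le)
  also have "\<dots> \<le> c * (m + n) + d * (m + n)"
    by (intro add_mono sparseD[OF assms(1)] sparseD[OF assms(2)] *)
  finally show "card (index_ones (\<lambda>x y. M x y \<or> N x y) f g A B) \<le> (c + d) * (m + n)"
    by (simp add: algebra_simps)
qed

lemma sparse_Bex: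
  assumes "finite T" "\<And>s. s \<in> T \<Longrightarrow> \<exists>c. sparse X r (M s) c"
  shows "\<exists>c. sparse X r (\<lambda>x y. \<exists>s\<in>T. M s x y) c"
  using assms
proof (induction T)
  case empty
  have "sparse X r (\<lambda>x y. \<exists>s\<in>{}. M s x y) 0" unfolding sparse_def index_ones_def by simp
  then show ?case by blast
next
  case (insert s T)
  obtain c where "sparse X r (M s) c" using insert.prems by auto
  moreover obtain d where "sparse X r (\<lambda>x y. \<exists>s\<in>T. M s x y) d" using insert by auto
  ultimately have "sparse X r (\<lambda>x y. M s x y \<or> (\<exists>s\<in>T. M s x y)) (c + d)" by (rule sparse_disj)
  then show ?case by auto
qed

text \<open>Induction along a sweep in increasing order: each new element lies above all earlier
  ones, so it can only join the current interval or open the next.\<close>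

lemma finite_max_induct [consumes 3, case_names empty insert]:
  assumes lin: "linear_order_on X r" and "finite Y" "Y \<subseteq> X"
    and "P {}"
    and step: "\<And>m Z. finite Z \<Longrightarrow> Z \<subseteq> X \<Longrightarrow> m \<in> X \<Longrightarrow> m \<notin> Z \<Longrightarrow>
      (\<And>z. z \<in> Z \<Longrightarrow> (m, z) \<notin> r) \<Longrightarrow> P Z \<Longrightarrow> P (insert m Z)"
  shows "P Y"
  using assms(2,3)
proof (induction "card Y" arbitrary: Y)
  case 0
  then show ?case using assms(4) by simp
next
  case (Suc n)
  have "\<exists>m\<in>Z. \<forall>z\<in>Z. (z, m) \<in> r" if "finite Z" "Z \<noteq> {}" "Z \<subseteq> X" for Z
    using that
  proof (induction rule: finite_ne_induct)
    case (singleton x)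
    then show ?case using linear_order_onD(1)[OF lin] by simp
  next
    case (insert x F)
    then obtain m where m: "m \<in> F" "\<And>z. z \<in> F \<Longrightarrow> (z, m) \<in> r" by auto
    have "(x, m) \<in> r \<or> (m, x) \<in> r" "(x, x) \<in> r"
      using linear_order_onD(1,2)[OF lin] insert.prems m(1) by auto
    then show ?case using m linear_order_onD(3)[OF lin] by (metis insert_iff)
  qed
  then obtain m where m: "m \<in> Y" "\<And>z. z \<in> Y \<Longrightarrow> (z, m) \<in> r"
    using Suc.hyps(2) Suc.prems by (metis card.empty nat.distinct(1))
  have "P (Y - {m})" using Suc m(1) by (intro Suc.hyps(1)) auto
  moreover have "(m, z) \<notin> r" if "z \<in> Y - {m}" for z
    using linear_order_onD(4)[OF lin] m(2) that by blast
  ultimately have "P (insert m (Y - {m}))" using Suc.prems m(1) by (intro step) auto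
  then show ?case using m(1) by (simp add: insert_absorb)
qed

text \<open>
  Cut \<open>Y\<close> greedily into intervals, starting a new one only when the current interval would
  see more than \<open>t\<close> values of one of the labellings.
\<close>
lemma greedy_intervals:
  assumes lin: "linear_order_on X r" and Y: "finite Y" "Y \<subseteq> X" and t: "t \<ge> 1"
  shows "\<exists>h q. index_map Y r h \<and> h ` Y \<subseteq> {..<q} \<and>
    (\<forall>i<q. card (a ` {y \<in> Y. h y = i}) \<le> t \<and> card (b ` {y \<in> Y. h y = i}) \<le> t) \<and>
    (\<forall>i. Suc i < q \<longrightarrow> t \<le> card (a ` {y \<in> Y. h y = i}) + card (b ` {y \<in> Y. h y = i}))"
  using lin Y
proof (induction rule: finite_max_induct)
  case empty
  show ?case by (rule exI[of _ "\<lambda>_. 0"], rule exI[of _ 0]) (simp add: monotone_on_def)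
next
  case (insert m Z)
  then obtain h q where h: "index_map Z r h" "h ` Z \<subseteq> {..<q}"
    and le: "\<And>i. i < q \<Longrightarrow> card (a ` {y \<in> Z. h y = i}) \<le> t \<and> card (b ` {y \<in> Z. h y = i}) \<le> t"
    and full: "\<And>i. Suc i < q \<Longrightarrow> t \<le> card (a ` {y \<in> Z. h y = i}) + card (b ` {y \<in> Z. h y = i})"
    by blast
  let ?F = "{y \<in> Z. h y = q - 1}"
  have upd: "{y \<in> insert m Z. (h(m := p)) y = i} =
      (if i = p then insert m {y \<in> Z. h y = i} else {y \<in> Z. h y = i})" for p i
    using insert.hyps(4) by auto
  have mono: "index_map (insert m Z) r (h(m := p))" if "\<And>z. z \<in> Z \<Longrightarrow> h z \<le> p" for p
    using h(1) insert.hyps(4,5) that unfolding monotone_on_def by auto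
  show ?case
  \<comment> \<open>For \<open>q = 0\<close> there is no current interval, while
    \<open>q - 1\<close> would denote 0; hence the guard.\<close>
  proof (cases "q > 0 \<and> card (a ` insert m ?F) \<le> t \<and> card (b ` insert m ?F) \<le> t")
    case True
    have "h z \<le> q - 1" if "z \<in> Z" for z using h(2) that by fastforce
    moreover define h' where "h' = h(m := q - 1)"
    ultimately have "index_map (insert m Z) r h'" using mono by simp
    moreover have "h' ` insert m Z \<subseteq> {..<q}" using h(2) True unfolding h'_def by auto
    moreover note upd[of "q - 1", folded h'_def]
    ultimately show ?thesis using True le full
      by (intro exI[of _ h'] exI[of _ q]) (auto simp del: image_insert)
  next
    case False
    have fin: "finite (a ` ?F)" "finite (b ` ?F)" using insert.hyps(1) by auto
    \<comment> \<open>A refused element raises each count by at most one, so the count it pushes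
      past \<open>t\<close> was already \<open>t\<close>. Bounding the sum avoids recording which of
      the two it was.\<close>
    have last: "t \<le> card (a ` ?F) + card (b ` ?F)" if "q > 0"
      using False that card_insert_le_m1[of t "a ` ?F" "a m"] card_insert_if[OF fin(1), of "a m"]
        card_insert_if[OF fin(2), of "b m"]
      by (auto split: if_splits)
    have "h z \<le> q" if "z \<in> Z" for z using h(2) that by fastforce
    moreover define h' where "h' = h(m := q)"
    ultimately have "index_map (insert m Z) r h'" using mono by simp
    moreover have "h' ` insert m Z \<subseteq> {..<Suc q}" using h(2) unfolding h'_def by fastforce
    moreover have new: "{y \<in> Z. h y = q} = {}" using h(2) by auto
    moreover have "t \<le> card (a ` {y \<in> Z. h y = i}) + card (b ` {y \<in> Z. h y = i})" if "i < q" for i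
      using full[of i] last that by (cases "Suc i = q") auto
    moreover have "{y \<in> insert m Z. h' y = q} = {m}"
      unfolding h'_def upd using new by auto
    moreover have "{y \<in> insert m Z. h' y = i} = {y \<in> Z. h y = i}" if "i < q" for i
      unfolding h'_def upd using that by simp
    ultimately show ?thesis using t le
      by (intro exI[of _ h'] exI[of _ "Suc q"]) (simp add: less_Suc_eq all_conj_distrib imp_disjL)
  qed
qed

text \<open>All \<open>q\<close> middle intervals but the last see at least \<open>t\<close> labels
  on the two sides together, whereas sparsity allows \<open>c * (m + q)\<close> on one side and
  \<open>d * (q + n)\<close> on the other. As \<open>t\<close> exceeds \<open>c + d\<close>, this
  bounds \<open>q\<close> linearly in \<open>m + n\<close>. Each middle interval links at most
  \<open>t * t\<close> pairs of labels, so the total is \<open>q * t * t\<close>, at most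
  \<open>2 * t ^ 3 * (m + n)\<close>.\<close>

lemma sparse_comp:
  assumes lin: "linear_order_on X r"
    and \<phi>: "inj_on \<phi> X" "\<phi> ` X \<subseteq> X"
    and spM: "sparse X r (\<lambda>x y. \<phi> x = y) c" and spN: "sparse X r (\<lambda>x y. \<psi> x = y) d"
  shows "sparse X r (\<lambda>x y. \<psi> (\<phi> x) = y) (2 * (c + d + 1) ^ 3)"
  unfolding sparse_def
proof (intro allI impI)
  fix A C f g m n
  assume *: "finite A" "finite C" "A \<subseteq> X" "C \<subseteq> X" "index_map A r f" "index_map C r g"
    and rng: "f ` A \<subseteq> {..<m}" "g ` C \<subseteq> {..<n}"
  let ?R = "index_ones (\<lambda>x y. \<psi> (\<phi> x) = y) f g A C"
  define t where "t = c + d + 1"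
  \<comment> \<open>Only middle points on a path from \<open>A\<close> to \<open>C\<close> are kept.
    On them \<open>a\<close> is the label of the preimage, which is unique by injectivity of
    \<open>\<phi>\<close>, and \<open>b\<close> is the label of the image.\<close>
  define Y where "Y = \<phi> ` {x \<in> A. \<psi> (\<phi> x) \<in> C}"
  define a where "a y = f (inv_into X \<phi> y)" for y
  define b where "b y = g (\<psi> y)" for y
  have Y: "finite Y" "Y \<subseteq> X" using * \<phi> unfolding Y_def by auto
  obtain h q where h: "index_map Y r h" "h ` Y \<subseteq> {..<q}"
    and le: "\<And>i. i < q \<Longrightarrow> card (a ` {y \<in> Y. h y = i}) \<le> t \<and> card (b ` {y \<in> Y. h y = i}) \<le> t"
    and full: "\<And>i. Suc i < q \<Longrightarrow> t \<le> card (a ` {y \<in> Y. h y = i}) + card (b ` {y \<in> Y. h y = i})"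
    using greedy_intervals[OF lin Y, of t a b] unfolding t_def by auto
  have fibA: "a (\<phi> x) = f x" if "x \<in> A" for x
    unfolding a_def using \<phi>(1) that *(3) by (simp add: inv_into_f_f subset_iff)
  \<comment> \<open>A middle interval together with a label it sees is a 1-entry in a quotient of
    the first matrix, with the middle intervals as columns.\<close>
  have "(\<Sum>i<q. card (a ` {y \<in> Y. h y = i})) = card (SIGMA i:{..<q}. a ` {y \<in> Y. h y = i})"
    using Y(1) by simp
  also have "\<dots> = card (prod.swap ` (SIGMA i:{..<q}. a ` {y \<in> Y. h y = i}))"
    by (rule card_image[symmetric]) simp
  also have "\<dots> \<le> card (index_ones (\<lambda>x y. \<phi> x = y) f h A Y)"
  proof (rule card_mono[OF finite_index_ones[OF *(1) Y(1)]])
    show "prod.swap ` (SIGMA i:{..<q}. a ` {y \<in> Y. h y = i}) \<subseteq> index_ones (\<lambda>x y. \<phi> x = y) f h A Y"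
      using fibA unfolding index_ones_def Y_def by auto
  qed
  also have "\<dots> \<le> c * (m + q)"
    by (intro sparseD[OF spM] * Y h rng)
  finally have sumA: "(\<Sum>i<q. card (a ` {y \<in> Y. h y = i})) \<le> c * (m + q)" .
  have "(\<Sum>i<q. card (b ` {y \<in> Y. h y = i})) = card (SIGMA i:{..<q}. b ` {y \<in> Y. h y = i})"
    using Y(1) by simp
  also have "\<dots> \<le> card (index_ones (\<lambda>x y. \<psi> x = y) h g Y C)"
  proof (rule card_mono[OF finite_index_ones[OF Y(1) *(2)]])
    show "(SIGMA i:{..<q}. b ` {y \<in> Y. h y = i}) \<subseteq> index_ones (\<lambda>x y. \<psi> x = y) h g Y C"
      unfolding index_ones_def Y_def b_def by auto
  qed
  also have "\<dots> \<le> d * (q + n)"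
    by (intro sparseD[OF spN] * Y h rng)
  finally have sumB: "(\<Sum>i<q. card (b ` {y \<in> Y. h y = i})) \<le> d * (q + n)" .
  have "(\<Sum>i<q - 1. t) \<le> (\<Sum>i<q - 1. card (a ` {y \<in> Y. h y = i}) + card (b ` {y \<in> Y. h y = i}))"
    using full by (intro sum_mono) simp
  also have "\<dots> \<le> (\<Sum>i<q. card (a ` {y \<in> Y. h y = i}) + card (b ` {y \<in> Y. h y = i}))"
    by (intro sum_mono2) auto
  also have "\<dots> \<le> c * (m + q) + d * (q + n)" unfolding sum.distrib using sumA sumB by simp
  finally have "(q - 1) * t \<le> c * (m + q) + d * (q + n)" by simp
  moreover have "q * t \<le> (q - 1) * t + t" by (cases q) auto
  ultimately have "q * t \<le> t + c * (m + q) + d * (q + n)" by linarith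
  \<comment> \<open>On the right \<open>q\<close> has coefficient \<open>c + d\<close>, one less
    than \<open>t\<close>, so one copy of \<open>q\<close> survives on the left.\<close>
  then have "q \<le> t + c * m + d * n" unfolding t_def by (simp add: algebra_simps)
  also have "\<dots> \<le> t + t * m + t * n" unfolding t_def by (intro add_mono mult_right_mono) auto
  finally have q: "q \<le> t * (1 + m + n)" by (simp add: algebra_simps)
  show "card ?R \<le> 2 * (c + d + 1) ^ 3 * (m + n)"
  proof (cases "?R = {}")
    case False
    \<comment> \<open>This absorbs the summand 1 in the bound for \<open>q\<close> into the factor
      2. An empty \<open>?R\<close> is treated apart since \<open>m + n\<close> may then be
      0.\<close>
    then have "m + n \<ge> 1" using rng unfolding index_ones_def by auto
    have "?R \<subseteq> (\<Union>i<q. a ` {y \<in> Y. h y = i} \<times> b ` {y \<in> Y. h y = i})"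
    proof
      fix p assume "p \<in> ?R"
      then obtain x where x: "x \<in> A" "\<psi> (\<phi> x) \<in> C" "p = (f x, g (\<psi> (\<phi> x)))"
        unfolding index_ones_def by auto
      then have "\<phi> x \<in> Y" "p = (a (\<phi> x), b (\<phi> x))" unfolding Y_def b_def using fibA by auto
      then show "p \<in> (\<Union>i<q. a ` {y \<in> Y. h y = i} \<times> b ` {y \<in> Y. h y = i})"
        using h(2) by (intro UN_I[of "h (\<phi> x)"]) auto
    qed
    then have "card ?R \<le> card (\<Union>i<q. a ` {y \<in> Y. h y = i} \<times> b ` {y \<in> Y. h y = i})"
      using Y(1) by (intro card_mono) auto
    also have "\<dots> \<le> (\<Sum>i<q. card (a ` {y \<in> Y. h y = i} \<times> b ` {y \<in> Y. h y = i}))"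
      by (rule card_UN_le) simp
    also have "\<dots> \<le> (\<Sum>i<q. t * t)"
      unfolding card_cartesian_product using le by (intro sum_mono mult_mono) auto
    also have "\<dots> = q * (t * t)" by simp
    also have "\<dots> \<le> (t * (1 + m + n)) * (t * t)" using q by (intro mult_right_mono) auto
    also have "\<dots> \<le> (t * (2 * (m + n))) * (t * t)"
      using \<open>m + n \<ge> 1\<close> by (intro mult_right_mono mult_left_mono) auto
    finally show ?thesis unfolding t_def[symmetric] by (simp add: power3_eq_cube ac_simps)
  qed simp
qed

section \<open>Finite strict twin-width of sparse matrices and graphs\<close>

text \<open>Applied to a graph with rows and columns partitioned alike, it also counts a part joined
  to itself, so it exceeds the degree in the quotient graph by at most one.\<close>

definition quotient_degree :: "('a \<Rightarrow> 'b \<Rightarrow> bool) \<Rightarrow> 'b set set \<Rightarrow> 'a set \<Rightarrow> nat" where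
  "quotient_degree M Q A = card {B \<in> Q. quotient_entry M A B}"

lemma quotient_entry_converse [simp]: "quotient_entry M\<inverse>\<inverse> B A \<longleftrightarrow> quotient_entry M A B"
  unfolding quotient_entry_def by auto

lemma quotient_degree_Un:
  "quotient_degree M Q (A \<union> B) \<le> quotient_degree M Q A + quotient_degree M Q B"
proof -
  have "{C \<in> Q. quotient_entry M (A \<union> B) C}
      = {C \<in> Q. quotient_entry M A C} \<union> {C \<in> Q. quotient_entry M B C}"
    unfolding quotient_entry_def by auto
  then show ?thesis unfolding quotient_degree_def by (simp add: card_Un_le)
qed

text \<open>Identifying \<open>A\<close> and \<open>B\<close> maps the old neighbours of
  \<open>D\<close> onto a set containing the new ones. Consequently a merge can raise the degree of
  the merged part only.\<close>

lemma quotient_degree_merge: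
  assumes "finite Q" "A \<in> Q" "B \<in> Q"
  shows "quotient_degree M (insert (A \<union> B) (Q - {A, B})) D \<le> quotient_degree M Q D"
proof -
  define \<phi> where "\<phi> C = (if C = A \<or> C = B then A \<union> B else C)" for C
  have "{C \<in> insert (A \<union> B) (Q - {A, B}). quotient_entry M D C}
      \<subseteq> \<phi> ` {C \<in> Q. quotient_entry M D C}"
  proof
    fix C assume C: "C \<in> {C \<in> insert (A \<union> B) (Q - {A, B}). quotient_entry M D C}"
    show "C \<in> \<phi> ` {C \<in> Q. quotient_entry M D C}"
    proof (cases "C = A \<union> B")
      case True
      then have "quotient_entry M D A \<or> quotient_entry M D B"
        using C unfolding quotient_entry_def by blast
      then show ?thesis using assms True unfolding \<phi>_def by auto
    next
      case False
      then show ?thesis using C unfolding \<phi>_def by force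
    qed
  qed
  then have "card {C \<in> insert (A \<union> B) (Q - {A, B}). quotient_entry M D C}
      \<le> card (\<phi> ` {C \<in> Q. quotient_entry M D C})"
    using assms(1) by (intro card_mono) auto
  also have "\<dots> \<le> card {C \<in> Q. quotient_entry M D C}"
    using assms(1) by (intro card_image_le) auto
  finally show ?thesis unfolding quotient_degree_def .
qed

lemma partition_on_merge:
  assumes "partition_on W P" "A \<in> P" "B \<in> P"
  shows "partition_on W (insert (A \<union> B) (P - {A, B}))"
proof (rule partition_onI)
  have P: "\<Union>P = W" "disjoint P" "{} \<notin> P" using assms(1) unfolding partition_on_def by auto
  show "\<Union> (insert (A \<union> B) (P - {A, B})) = W" using P(1) assms(2,3) by auto
  show "{} \<notin> insert (A \<union> B) (P - {A, B})" using P(3) assms(2) by auto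
  have "disjnt (A \<union> B) C" if "C \<in> P - {A, B}" for C
    using disjointD[OF P(2) assms(2), of C] disjointD[OF P(2) assms(3), of C] that
    unfolding disjnt_def by auto
  moreover have "disjnt C D" if "C \<in> P" "D \<in> P" "C \<noteq> D" for C D
    using disjointD[OF P(2)] that unfolding disjnt_def by auto
  ultimately show "disjnt p q"
    if "p \<in> insert (A \<union> B) (P - {A, B})" "q \<in> insert (A \<union> B) (P - {A, B})" "p \<noteq> q" for p q
    using that by (metis DiffD1 disjnt_sym insertE)
qed

lemma mergesI:
  "A \<in> P \<Longrightarrow> B \<in> P \<Longrightarrow> A \<noteq> B \<Longrightarrow> merges P (insert (A \<union> B) (P - {A, B}))"
  unfolding merges_def by blast

lemma card_merge:
  assumes "finite P" "A \<in> P" "B \<in> P" "A \<noteq> B"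
  shows "card (insert (A \<union> B) (P - {A, B})) < card P"
proof -
  have "card (P - {A, B}) = card P - 2" "card P \<ge> 2"
    using assms card_mono[of P "{A, B}"] by (simp_all add: card_Diff_subset)
  then show ?thesis using card_insert_le_m1[of "card P - 1" "P - {A, B}" "A \<union> B"] by linarith
qed

lemma partition_card_le_1:
  assumes "partition_on W P" "finite P" "card P \<le> 1"
  shows "P = one_part W"
proof (cases "P = {}")
  case True
  then show ?thesis using assms(1) unfolding one_part_def partition_on_def by auto
next
  case False
  then have "card P = 1" using assms by (metis One_nat_def card_gt_0_iff le_antisym less_eq_Suc_le)
  then obtain A where "P = {A}" by (rule card_1_singletonE)
  then show ?thesis using assms(1) unfolding one_part_def partition_on_def by auto
qed

lemma interval_partition_singletons:
  assumes "linear_order_on X r" "W \<subseteq> X" "finite W"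
  shows "interval_partition W r (singleton_parts W)"
  using assms(2,3) linear_order_onD(4)[OF assms(1)]
  unfolding interval_partition_def partition_on_def singleton_parts_def interval_on_def disjoint_def
  by auto

lemma quotient_degree_singletons:
  "quotient_degree M (singleton_parts V) {x} = card {y \<in> V. M x y}"
proof -
  have "{B \<in> singleton_parts V. quotient_entry M {x} B} = (\<lambda>y. {y}) ` {y \<in> V. M x y}"
    unfolding singleton_parts_def quotient_entry_def by auto
  then show ?thesis unfolding quotient_degree_def by (simp add: card_image)
qed

section \<open>Light merges and the sequences built from them\<close>

text \<open>Averaging over the \<open>k\<close> consecutive pairs among \<open>k + 1\<close> parts.
  Each part lies in at most two pairs, so the pair sums total at most
  \<open>2 * C * (k + 1)\<close>, which is at most \<open>4 * C * k\<close>. Consecutive parts are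
  taken because their union is again an interval.\<close>

lemma light_consecutive_pair:
  assumes lin: "linear_order_on X r" and W: "W \<subseteq> X" and P: "interval_partition W r P"
    and two: "card P \<ge> 2" and sum: "(\<Sum>A\<in>P. d A) \<le> C * card P"
  obtains A B where "A \<in> P" "B \<in> P" "A \<noteq> B" "interval_on W r (A \<union> B)" "d A + d B \<le> 4 * C"
proof -
  obtain f where f: "index_map W r f" "f ` W = {..<card P}"
    and Pf: "P = (\<lambda>i. {x \<in> W. f x = i}) ` {..<card P}"
    by (rule interval_partition_index_map[OF lin W P])
  define part where "part i = {x \<in> W. f x = i}" for i
  obtain k where k: "card P = Suc k" "k \<ge> 1" using two by (cases "card P") auto
  have inj: "inj_on part {..<card P}"
  proof (rule inj_onI)
    fix i j assume i: "i \<in> {..<card P}" and eq: "part i = part j"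
    then obtain x where x: "x \<in> W" "f x = i" unfolding f(2)[symmetric] by blast
    then have "x \<in> part j" unfolding eq[symmetric] by (simp add: part_def)
    then show "i = j" using x(2) by (simp add: part_def)
  qed
  have Pp: "P = part ` {..<card P}" using Pf unfolding part_def .
  have "\<exists>i<k. d (part i) + d (part (Suc i)) \<le> 4 * C"
  proof (rule ccontr)
    assume "\<not> ?thesis"
    then have "(\<Sum>i<k. 4 * C + 1) \<le> (\<Sum>i<k. d (part i) + d (part (Suc i)))"
      by (intro sum_mono) (auto simp: not_le)
    also have "\<dots> = (\<Sum>i<k. d (part i)) + (\<Sum>i<k. d (part (Suc i)))" by (rule sum.distrib)
    also have "\<dots> \<le> (\<Sum>i<Suc k. d (part i)) + (\<Sum>i<Suc k. d (part i))"
      by (intro add_mono) (simp, subst sum.lessThan_Suc_shift, simp)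
    also have "(\<Sum>i<Suc k. d (part i)) = (\<Sum>A\<in>P. d A)"
      using arg_cong[OF Pp, of "sum d"] sum.reindex[OF inj, of d] unfolding k(1) by simp
    finally have "k * (4 * C + 1) \<le> 2 * (\<Sum>A\<in>P. d A)" by simp
    also have "\<dots> \<le> 2 * (C * Suc k)" using sum unfolding k(1) by simp
    also have "\<dots> \<le> 2 * (C * (2 * k))" using k(2) by (intro mult_left_mono) auto
    finally show False using k(2) by (simp add: algebra_simps)
  qed
  then obtain i where i: "i < k" "d (part i) + d (part (Suc i)) \<le> 4 * C" by blast
  have "part i \<union> part (Suc i) = {x \<in> W. f x \<in> {i, Suc i}}" unfolding part_def by auto
  moreover have "interval_on W r {x \<in> W. f x \<in> {i, Suc i}}"
    by (rule index_map_interval[OF f(1)]) auto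
  moreover have "part i \<in> P" "part (Suc i) \<in> P" using i(1) k(1) Pp by auto
  moreover have "part i \<noteq> part (Suc i)" using inj_onD[OF inj, of i "Suc i"] i(1) k(1) by auto
  ultimately show thesis using i(2) that by metis
qed

text \<open>The degree sum counts the 1-entries of the quotient matrix.\<close>

lemma sparse_sum_quotient_degree:
  assumes lin: "linear_order_on X r" and sp: "sparse X r M c"
    and U: "finite U" "U \<subseteq> X" "interval_partition U r P"
    and V: "finite V" "V \<subseteq> X" "interval_partition V r Q"
  shows "(\<Sum>A\<in>P. quotient_degree M Q A) \<le> c * (card P + card Q)"
proof -
  obtain f where f: "index_map U r f" "f ` U = {..<card P}"
    and Pf: "P = (\<lambda>i. {x \<in> U. f x = i}) ` {..<card P}"
    by (rule interval_partition_index_map[OF lin U(2,3)])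
  obtain g where g: "index_map V r g" "g ` V = {..<card Q}"
    and Qg: "Q = (\<lambda>i. {x \<in> V. g x = i}) ` {..<card Q}"
    by (rule interval_partition_index_map[OF lin V(2,3)])
  have fin: "finite P" "finite Q" using U(3) V(3) unfolding interval_partition_def by auto
  have "(\<Sum>A\<in>P. quotient_degree M Q A) = card (SIGMA A:P. {B \<in> Q. quotient_entry M A B})"
    unfolding quotient_degree_def using fin by simp
  also have "\<dots> \<le> card ((\<lambda>(i, j). ({x \<in> U. f x = i}, {x \<in> V. g x = j})) ` index_ones M f g U V)"
  proof (intro card_mono finite_imageI finite_index_ones U(1) V(1) subsetI)
    fix p assume "p \<in> (SIGMA A:P. {B \<in> Q. quotient_entry M A B})"
    then obtain A B where p: "p = (A, B)" "A \<in> P" "B \<in> Q" "quotient_entry M A B" by auto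
    obtain i j where ij: "A = {x \<in> U. f x = i}" "B = {x \<in> V. g x = j}"
      using subsetD[OF equalityD1[OF Pf] p(2)] subsetD[OF equalityD1[OF Qg] p(3)] by blast
    have "(i, j) \<in> index_ones M f g U V"
      using p(4) unfolding ij quotient_entry_def index_ones_def by blast
    then show "p \<in> (\<lambda>(i, j). ({x \<in> U. f x = i}, {x \<in> V. g x = j})) ` index_ones M f g U V"
      unfolding p(1) ij by (intro image_eqI[of _ _ "(i, j)"]) simp
  qed
  also have "\<dots> \<le> card (index_ones M f g U V)"
    by (intro card_image_le finite_index_ones U(1) V(1))
  also have "\<dots> \<le> c * (card P + card Q)" using f g U V by (intro sparseD[OF sp]) auto
  finally show ?thesis .
qed

text \<open>On the side with more parts the number of 1-entries is at most
  \<open>c * (2 * card P)\<close>, so the average degree is at most \<open>2 * c\<close>, and the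
  light pair costs four times that.\<close>

lemma sparse_light_merge:
  assumes lin: "linear_order_on X r" and sp: "sparse X r M c"
    and U: "finite U" "U \<subseteq> X" "interval_partition U r P"
    and V: "finite V" "V \<subseteq> X" "interval_partition V r Q"
    and two: "card P \<ge> 2" and le: "card Q \<le> card P"
  obtains A B where "A \<in> P" "B \<in> P" "A \<noteq> B"
    "interval_partition U r (insert (A \<union> B) (P - {A, B}))" "quotient_degree M Q (A \<union> B) \<le> 8 * c"
proof -
  have "(\<Sum>A\<in>P. quotient_degree M Q A) \<le> c * (card P + card Q)"
    by (rule sparse_sum_quotient_degree[OF lin sp U V])
  also have "\<dots> \<le> c * (2 * card P)" using le by (intro mult_left_mono) auto
  finally have "(\<Sum>A\<in>P. quotient_degree M Q A) \<le> 2 * c * card P" by simp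
  then obtain A B where AB: "A \<in> P" "B \<in> P" "A \<noteq> B" "interval_on U r (A \<union> B)"
    "quotient_degree M Q A + quotient_degree M Q B \<le> 4 * (2 * c)"
    by (rule light_consecutive_pair[OF lin U(2,3) two])
  have "interval_partition U r (insert (A \<union> B) (P - {A, B}))"
    using U(3) AB partition_on_merge unfolding interval_partition_def by auto
  moreover have "quotient_degree M Q (A \<union> B) \<le> 8 * c"
    using quotient_degree_Un[of M Q A B] AB(5) by simp
  ultimately show thesis using that AB by blast
qed

lemma sparse_converse:
  assumes "sparse X r M c"
  shows "sparse X r M\<inverse>\<inverse> c"
  unfolding sparse_def
proof (intro allI impI)
  fix A B f g m n
  assume *: "finite A" "finite B" "A \<subseteq> X" "B \<subseteq> X" "index_map A r f" "index_map B r g"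
    "f ` A \<subseteq> {..<m}" "g ` B \<subseteq> {..<n}"
  have "index_ones M\<inverse>\<inverse> f g A B = (index_ones M g f B A)\<inverse>" unfolding index_ones_def by auto
  then have "card (index_ones M\<inverse>\<inverse> f g A B) = card (index_ones M g f B A)" by (simp add: card_inverse)
  also have "\<dots> \<le> c * (n + m)" by (intro sparseD[OF assms] *)
  finally show "card (index_ones M\<inverse>\<inverse> f g A B) \<le> c * (m + n)" by (simp add: add.commute)
qed

lemma division_width_le_iff:
  "division_width M (P, Q) \<le> enat t \<longleftrightarrow>
     (\<forall>A\<in>P. quotient_degree M Q A \<le> t) \<and> (\<forall>B\<in>Q. quotient_degree M\<inverse>\<inverse> P B \<le> t)"
  unfolding division_width_def quotient_degree_def by (auto simp: SUP_le_iff)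

text \<open>Merging always on the side with more parts keeps the width at most \<open>t\<close>: the
  new part has degree at most \<open>8 * c\<close>, and no other degree increases.\<close>

lemma sparse_division_chain:
  assumes lin: "linear_order_on X r" and sp: "sparse X r M c" and t: "8 * c \<le> t"
    and U: "finite U" "U \<subseteq> X" and V: "finite V" "V \<subseteq> X"
    and "division U r V r (P, Q)" "division_width M (P, Q) \<le> enat t"
  shows "\<exists>Ds. Ds \<noteq> [] \<and> hd Ds = (P, Q) \<and> last Ds = (one_part U, one_part V) \<and>
    successively division_step Ds \<and>
    (\<forall>D\<in>set Ds. division U r V r D \<and> division_width M D \<le> enat t)"
  using assms(8,9)
proof (induction "card P + card Q" arbitrary: P Q rule: less_induct)
  case less
  have PQ: "interval_partition U r P" "interval_partition V r Q"
    using less.prems(1) unfolding division_def by auto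
  then have part: "partition_on U P" "partition_on V Q" and fin: "finite P" "finite Q"
    unfolding interval_partition_def by auto
  have deg: "\<And>A. A \<in> P \<Longrightarrow> quotient_degree M Q A \<le> t" "\<And>B. B \<in> Q \<Longrightarrow> quotient_degree M\<inverse>\<inverse> P B \<le> t"
    using less.prems(2) unfolding division_width_le_iff by auto
  have extend: ?case
    if ext: "card P' + card Q' < card P + card Q" "division_step (P, Q) (P', Q')"
      "division U r V r (P', Q')" "division_width M (P', Q') \<le> enat t" for P' Q'
  proof -
    obtain Ds where "Ds \<noteq> []" "hd Ds = (P', Q')" "last Ds = (one_part U, one_part V)"
      "successively division_step Ds" "\<forall>D\<in>set Ds. division U r V r D \<and> division_width M D \<le> enat t"
      using less.hyps[OF ext(1,3,4)] by blast
    then show ?thesis using ext(2) less.prems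
      by (intro exI[of _ "(P, Q) # Ds"]) (auto simp: successively_Cons)
  qed
  consider "card P \<le> 1" "card Q \<le> 1" | "card P \<ge> 2" "card Q \<le> card P" | "card Q \<ge> 2" "card P \<le> card Q"
    by linarith
  then show ?case
  proof cases
    case 1
    then have "P = one_part U" "Q = one_part V" using partition_card_le_1 part fin by blast+
    then show ?thesis using less.prems by (intro exI[of _ "[(P, Q)]"]) simp
  next
    case 2
    obtain A B where AB: "A \<in> P" "B \<in> P" "A \<noteq> B"
      "interval_partition U r (insert (A \<union> B) (P - {A, B}))" "quotient_degree M Q (A \<union> B) \<le> 8 * c"
      by (rule sparse_light_merge[OF lin sp U PQ(1) V PQ(2) 2])
    show ?thesis
    proof (rule extend)
      show "card (insert (A \<union> B) (P - {A, B})) + card Q < card P + card Q"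
        using card_merge[OF fin(1) AB(1-3)] by simp
      show "division_step (P, Q) (insert (A \<union> B) (P - {A, B}), Q)"
        unfolding division_step_def using mergesI[OF AB(1-3)] by simp
      show "division U r V r (insert (A \<union> B) (P - {A, B}), Q)"
        unfolding division_def using AB(4) PQ(2) by simp
      show "division_width M (insert (A \<union> B) (P - {A, B}), Q) \<le> enat t"
        unfolding division_width_le_iff
        using AB(5) t deg quotient_degree_merge[OF fin(1) AB(1,2), of "M\<inverse>\<inverse>"]
        by (auto intro: order_trans)
    qed
  next
    case 3
    obtain A B where AB: "A \<in> Q" "B \<in> Q" "A \<noteq> B"
      "interval_partition V r (insert (A \<union> B) (Q - {A, B}))"
      "quotient_degree M\<inverse>\<inverse> P (A \<union> B) \<le> 8 * c"
      by (rule sparse_light_merge[OF lin sparse_converse[OF sp] V PQ(2) U PQ(1) 3])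
    show ?thesis
    proof (rule extend)
      show "card P + card (insert (A \<union> B) (Q - {A, B})) < card P + card Q"
        using card_merge[OF fin(2) AB(1-3)] by simp
      show "division_step (P, Q) (P, insert (A \<union> B) (Q - {A, B}))"
        unfolding division_step_def using mergesI[OF AB(1-3)] by simp
      show "division U r V r (P, insert (A \<union> B) (Q - {A, B}))"
        unfolding division_def using AB(4) PQ(1) by simp
      show "division_width M (P, insert (A \<union> B) (Q - {A, B})) \<le> enat t"
        unfolding division_width_le_iff
        using AB(5) t deg quotient_degree_merge[OF fin(2) AB(1,2), of M]
        by (auto intro: order_trans)
    qed
  qed
qed

theorem sparse_matrix_stww_finite:
  assumes lin: "linear_order_on X r" and sp: "sparse X r M c"
    and deg: "\<And>x V. finite V \<Longrightarrow> V \<subseteq> X \<Longrightarrow> x \<in> X \<Longrightarrow> card {y \<in> V. M x y} \<le> d"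
      "\<And>y U. finite U \<Longrightarrow> U \<subseteq> X \<Longrightarrow> y \<in> X \<Longrightarrow> card {x \<in> U. M x y} \<le> d"
  shows "matrix_stww X r X r M < \<infinity>"
proof -
  \<comment> \<open>The bound \<open>d\<close> serves the division into singletons,
    \<open>8 * c\<close> every part created later.\<close>
  define t where "t = max d (8 * c)"
  have "finite_matrix_stww U r V r M \<le> enat t" if UV: "finite U" "U \<subseteq> X" "finite V" "V \<subseteq> X" for U V
  proof -
    let ?D = "(singleton_parts U, singleton_parts V)"
    have "division U r V r ?D"
      unfolding division_def using interval_partition_singletons[OF lin] UV by simp
    moreover have "division_width M ?D \<le> enat t"
    proof -
      have "quotient_degree M (singleton_parts V) A \<le> t" if "A \<in> singleton_parts U" for A
      proof -
        from that obtain x where "A = {x}" "x \<in> U" unfolding singleton_parts_def by auto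
        then show ?thesis using deg(1)[OF UV(3,4), of x] UV(2)
          unfolding t_def by (auto simp: quotient_degree_singletons intro: max.coboundedI1)
      qed
      moreover have "quotient_degree M\<inverse>\<inverse> (singleton_parts U) B \<le> t" if "B \<in> singleton_parts V" for B
      proof -
        from that obtain x where "B = {x}" "x \<in> V" unfolding singleton_parts_def by auto
        then show ?thesis using deg(2)[OF UV(1,2), of x] UV(4)
          unfolding t_def by (auto simp: quotient_degree_singletons intro: max.coboundedI1)
      qed
      ultimately show ?thesis unfolding division_width_le_iff by blast
    qed
    moreover have "8 * c \<le> t" unfolding t_def by simp
    ultimately obtain Ds where "Ds \<noteq> []" "hd Ds = ?D" "last Ds = (one_part U, one_part V)"
      "successively division_step Ds" "\<forall>D\<in>set Ds. division U r V r D \<and> division_width M D \<le> enat t"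
      using sparse_division_chain[OF lin sp _ UV] by blast
    then have "Ds \<in> {Ds. division_sequence U r V r Ds}" "(SUP D\<in>set Ds. division_width M D) \<le> enat t"
      unfolding division_sequence_def by (auto simp: SUP_le_iff)
    then show ?thesis unfolding finite_matrix_stww_def by (rule INF_lower2)
  qed
  then have "matrix_stww X r X r M \<le> enat t" unfolding matrix_stww_def by (auto intro!: SUP_least)
  then show ?thesis by (rule le_less_trans) simp
qed

lemma sparse_partition_chain:
  assumes lin: "linear_order_on X r" and sp: "sparse X r E c" and t: "8 * c \<le> t"
    and W: "finite W" "W \<subseteq> X"
    and "interval_partition W r P" "\<And>A. A \<in> P \<Longrightarrow> quotient_degree E P A \<le> t"
  shows "\<exists>Ps. Ps \<noteq> [] \<and> hd Ps = P \<and> last Ps = one_part W \<and> successively merges Ps \<and>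
    (\<forall>P\<in>set Ps. partition_on W P \<and> (\<forall>A\<in>P. quotient_degree E P A \<le> t))"
  using assms(6,7)
proof (induction "card P" arbitrary: P rule: less_induct)
  case less
  then have part: "partition_on W P" and fin: "finite P" unfolding interval_partition_def by auto
  show ?case
  proof (cases "card P \<le> 1")
    case True
    then have "P = one_part W" using partition_card_le_1 part fin by blast
    then show ?thesis using less.prems part by (intro exI[of _ "[P]"]) simp
  next
    case False
    then have two: "card P \<ge> 2" by simp
    obtain A B where AB: "A \<in> P" "B \<in> P" "A \<noteq> B"
      "interval_partition W r (insert (A \<union> B) (P - {A, B}))" "quotient_degree E P (A \<union> B) \<le> 8 * c"
      by (rule sparse_light_merge[OF lin sp W less.prems(1) W less.prems(1) two order_refl])
    let ?P' = "insert (A \<union> B) (P - {A, B})"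
    \<comment> \<open>The merge is performed in two stages, first on the rows and then on the
      columns. The first gives the new part degree at most \<open>8 * c\<close> relative to
      \<open>P\<close>; the second increases no degree.\<close>
    have "quotient_degree E ?P' D \<le> t" if "D \<in> ?P'" for D
      using that AB(5) t less.prems(2) quotient_degree_merge[OF fin AB(1,2), of E D]
      by (auto intro: order_trans)
    then obtain Ps where "Ps \<noteq> []" "hd Ps = ?P'" "last Ps = one_part W" "successively merges Ps"
      "\<forall>P\<in>set Ps. partition_on W P \<and> (\<forall>A\<in>P. quotient_degree E P A \<le> t)"
      using less.hyps[OF card_merge[OF fin AB(1-3)] AB(4)] by blast
    moreover have "merges P ?P'" using mergesI[OF AB(1-3)] .
    ultimately show ?thesis using less.prems(2) part
      by (intro exI[of _ "P # Ps"]) (auto simp: successively_Cons)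
  qed
qed

theorem sparse_graph_stww_finite:
  assumes lin: "linear_order_on X r" and sp: "sparse X r E c"
    and deg: "\<And>x V. finite V \<Longrightarrow> V \<subseteq> X \<Longrightarrow> x \<in> X \<Longrightarrow> card {y \<in> V. E x y} \<le> d"
  shows "graph_stww X E < \<infinity>"
proof -
  define t where "t = max d (8 * c)"
  have "finite_graph_stww W E \<le> enat t" if W: "finite W" "W \<subseteq> X" for W
  proof -
    have "quotient_degree E (singleton_parts W) A \<le> t" if "A \<in> singleton_parts W" for A
    proof -
      from that obtain x where "A = {x}" "x \<in> W" unfolding singleton_parts_def by auto
      then show ?thesis using deg[OF W, of x] W(2)
        unfolding t_def by (auto simp: quotient_degree_singletons intro: max.coboundedI1)
    qed
    moreover have "8 * c \<le> t" unfolding t_def by simp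
    ultimately obtain Ps where Ps: "Ps \<noteq> []" "hd Ps = singleton_parts W" "last Ps = one_part W"
      "successively merges Ps"
      "\<forall>P\<in>set Ps. partition_on W P \<and> (\<forall>A\<in>P. quotient_degree E P A \<le> t)"
      using sparse_partition_chain[OF lin sp _ W interval_partition_singletons[OF lin W(2,1)]] by blast
    have "card {B \<in> P. quotient_graph_adj E A B} \<le> t" if "P \<in> set Ps" "A \<in> P" for P A
    proof -
      \<comment> \<open>Quotient graphs have no loops, hence an inequality between the two counts
        rather than an equality.\<close>
      have "finite P" using Ps(5) that(1) W(1) finite_elements by blast
      then have "card {B \<in> P. quotient_graph_adj E A B} \<le> quotient_degree E P A"
        unfolding quotient_degree_def quotient_graph_adj_def quotient_entry_def
        by (intro card_mono) auto
      then show ?thesis using Ps(5) that by (meson order_trans)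
    qed
    then have "(SUP P\<in>set Ps. quotient_max_degree E P) \<le> enat t"
      unfolding quotient_max_degree_def by (auto simp: SUP_le_iff)
    moreover have "Ps \<in> {Ps. partition_sequence W Ps}" using Ps unfolding partition_sequence_def by auto
    ultimately show ?thesis unfolding finite_graph_stww_def by (intro INF_lower2)
  qed
  then have "graph_stww X E \<le> enat t" unfolding graph_stww_def by (auto intro!: SUP_least)
  then show ?thesis by (rule le_less_trans) simp
qed

section \<open>Grids bound the strict twin-width from below\<close>

lemma three_elements:
  assumes "card (S :: nat set) \<ge> 3"
  obtains i j l where "i \<in> S" "j \<in> S" "l \<in> S" "i < j" "j < l"
proof -
  have fin: "finite S" using assms by (metis card.infinite not_numeral_le_zero)
  have ne: "S \<noteq> {}" using assms by auto
  have "card {Min S, Max S} \<le> 2" by (simp add: card_insert_if)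
  then have "\<not> S \<subseteq> {Min S, Max S}" using assms card_mono[of "{Min S, Max S}" S] by auto
  then obtain j where j: "j \<in> S" "j \<noteq> Min S" "j \<noteq> Max S" by blast
  have "Min S < j" "j < Max S" using Min_le[OF fin j(1)] Max_ge[OF fin j(1)] j by auto
  then show thesis using that Min_in[OF fin ne] Max_in[OF fin ne] j(1) by blast
qed

text \<open>
  An interval that meets three row classes of a grid contains the middle one, hence it sees all
  columns of the grid.
\<close>
lemma big_interval_degree:
  assumes lin: "linear_order_on X r" and U: "U \<subseteq> X" and f: "index_map U r f" "f ` U = {..<k}"
    and ones: "{..<k} \<times> {..<k} \<subseteq> index_ones M f g U V"
    and I: "interval_on U r I" "card (f ` I) \<ge> 3"
    and Q: "partition_on V Q" "finite V" "\<And>B. B \<in> Q \<Longrightarrow> card (g ` B) \<le> q"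
  shows "k \<le> q * quotient_degree M Q I"
proof -
  obtain i j l where ijl: "i \<in> f ` I" "j \<in> f ` I" "l \<in> f ` I" "i < j" "j < l"
    by (rule three_elements[OF I(2)])
  then obtain a b where ab: "a \<in> I" "b \<in> I" "f a = i" "f b = l" by blast
  have IU: "I \<subseteq> U" using I(1) unfolding interval_on_def by auto
  have below: "(x, y) \<in> r" if "x \<in> U" "y \<in> U" "f x < f y" for x y
  proof -
    have "\<not> (y, x) \<in> r" using monotone_onD[OF f(1), of y x] that by auto
    then show ?thesis using linear_order_onD(2)[OF lin, of x y] that U by blast
  qed
  have mid: "x \<in> I" if "x \<in> U" "f x = j" for x
  proof -
    have "(a, x) \<in> r" "(x, b) \<in> r" using below ab ijl that IU by auto
    then show ?thesis using I(1) ab(1,2) that(1) unfolding interval_on_def by blast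
  qed
  have jk: "j < k" using f(2) ijl(2) IU by auto
  define T where "T = {B \<in> Q. quotient_entry M I B}"
  have finQ: "finite Q" using Q(1,2) by (rule finite_elements[rotated])
  have finB: "finite B" if "B \<in> Q" for B
    using Q(1,2) that by (auto simp: partition_on_def intro: finite_subset)
  have "{..<k} \<subseteq> (\<Union>B\<in>T. g ` B)"
  proof
    fix c assume "c \<in> {..<k}"
    then have "(j, c) \<in> index_ones M f g U V" using ones jk by auto
    then obtain x y where xy: "x \<in> U" "y \<in> V" "M x y" "f x = j" "g y = c"
      unfolding index_ones_def by auto
    then obtain B where B: "B \<in> Q" "y \<in> B" using Q(1) unfolding partition_on_def by auto
    then have "B \<in> T" using mid xy unfolding T_def quotient_entry_def by blast
    then show "c \<in> (\<Union>B\<in>T. g ` B)" using B(2) xy(5) by blast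
  qed
  moreover have "finite T" unfolding T_def using finQ by simp
  ultimately have "card {..<k} \<le> card (\<Union>B\<in>T. g ` B)"
    using finB unfolding T_def by (intro card_mono) auto
  also have "\<dots> \<le> (\<Sum>B\<in>T. card (g ` B))" by (rule card_UN_le[OF \<open>finite T\<close>])
  also have "\<dots> \<le> (\<Sum>B\<in>T. q)" using Q(3) unfolding T_def by (intro sum_mono) auto
  finally show ?thesis unfolding quotient_degree_def T_def by (simp add: mult.commute)
qed

lemma successively_first_failure:
  assumes "successively R xs" "xs \<noteq> []" "P (hd xs)" "\<not> P (last xs)"
  shows "\<exists>x\<in>set xs. \<exists>y\<in>set xs. R x y \<and> P x \<and> \<not> P y"
  using assms
proof (induction xs)
  case (Cons x xs)
  show ?case
  proof (cases "xs = []")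
    case False
    then show ?thesis using Cons by (cases "P (hd xs)") (auto simp: successively_Cons)
  qed (use Cons in simp)
qed simp

lemma card_image_one_part:
  assumes "f ` V = {..<k::nat}" "k \<ge> 3"
  shows "\<exists>A\<in>one_part V. \<not> card (f ` A) \<le> 2"
proof
  have "card (f ` V) = k" using assms(1) by simp
  then show "\<not> card (f ` V) \<le> 2" "V \<in> one_part V" using assms(2) unfolding one_part_def by auto
qed

lemma card_image_singleton_parts: "A \<in> singleton_parts V \<Longrightarrow> card (f ` A) \<le> 2"
  unfolding singleton_parts_def by auto

text \<open>At the first division with a part that meets three classes, the preceding step has
  changed only one side. The parts on the other side therefore still meet at most two classes each,
  which gives \<open>k \<le> 2 * w\<close>. The summand 2 covers \<open>k < 3\<close>, where no part
  meets three classes.\<close>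

lemma matrix_grid_bound:
  assumes lin: "linear_order_on X r" and UV: "U \<subseteq> X" "V \<subseteq> X" "finite U" "finite V"
    and f: "index_map U r f" "f ` U = {..<k}" and g: "index_map V r g" "g ` V = {..<k}"
    and ones: "{..<k} \<times> {..<k} \<subseteq> index_ones M f g U V"
    and seq: "division_sequence U r V r Ds" "\<And>D. D \<in> set Ds \<Longrightarrow> division_width M D \<le> enat w"
  shows "k \<le> 2 * w + 2"
proof (cases "k \<ge> 3")
  case True
  define good where "good D \<longleftrightarrow> (\<forall>A\<in>fst D. card (f ` A) \<le> 2) \<and> (\<forall>B\<in>snd D. card (g ` B) \<le> 2)" for D
  have "good (hd Ds)" using seq(1) card_image_singleton_parts
    unfolding division_sequence_def good_def by auto
  moreover have "\<not> good (last Ds)" using seq(1) card_image_one_part[OF f(2) True]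
    unfolding division_sequence_def good_def by auto
  ultimately obtain D D' where DD': "D' \<in> set Ds" "division_step D D'" "good D" "\<not> good D'"
    using successively_first_failure[of division_step Ds good] seq(1)
    unfolding division_sequence_def by blast
  obtain P Q where D': "D' = (P, Q)" by (cases D')
  have PQ: "interval_partition U r P" "interval_partition V r Q"
    using seq(1) DD'(1) unfolding division_sequence_def division_def D' by auto
  have wd: "\<And>A. A \<in> P \<Longrightarrow> quotient_degree M Q A \<le> w" "\<And>B. B \<in> Q \<Longrightarrow> quotient_degree M\<inverse>\<inverse> P B \<le> w"
    using seq(2)[OF DD'(1)] unfolding D' division_width_le_iff by auto
  have part: "partition_on U P" "partition_on V Q"
    and int: "\<And>A. A \<in> P \<Longrightarrow> interval_on U r A" "\<And>B. B \<in> Q \<Longrightarrow> interval_on V r B"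
    using PQ unfolding interval_partition_def by auto
  consider "snd D = Q" | "fst D = P" using DD'(2) unfolding division_step_def D' by auto
  then have "k \<le> 2 * w"
  proof cases
    case 1
    then have small: "\<And>B. B \<in> Q \<Longrightarrow> card (g ` B) \<le> 2" using DD'(3) unfolding good_def by auto
    then obtain I where I: "I \<in> P" "card (f ` I) \<ge> 3" using DD'(4) unfolding good_def D' by fastforce
    have "k \<le> 2 * quotient_degree M Q I"
      by (rule big_interval_degree[OF lin UV(1) f ones int(1)[OF I(1)] I(2) part(2) UV(4) small])
    then show ?thesis using wd(1)[OF I(1)] by linarith
  next
    case 2
    then have small: "\<And>A. A \<in> P \<Longrightarrow> card (f ` A) \<le> 2" using DD'(3) unfolding good_def by auto
    then obtain I where I: "I \<in> Q" "card (g ` I) \<ge> 3" using DD'(4) unfolding good_def D' by fastforce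
    have ones': "{..<k} \<times> {..<k} \<subseteq> index_ones M\<inverse>\<inverse> g f V U"
      using ones unfolding index_ones_def by fast
    have "k \<le> 2 * quotient_degree M\<inverse>\<inverse> P I"
      by (rule big_interval_degree[OF lin UV(2) g ones' int(2)[OF I(1)] I(2) part(1) UV(3) small])
    then show ?thesis using wd(2)[OF I(1)] by linarith
  qed
  then show ?thesis by simp
qed simp

theorem matrix_stww_finite_sparse:
  assumes lin: "linear_order_on X r" and fin: "matrix_stww X r X r M < \<infinity>"
  shows "\<exists>c. sparse X r M c"
proof -
  obtain w' where w': "matrix_stww X r X r M = enat w'" using fin by auto
  \<comment> \<open>The successor makes the bound strict, so that the infimum yields an actual
    division sequence of width below \<open>w\<close>.\<close>
  define w where "w = Suc w'"
  have no: "\<not> index_grid X r M (2 * w + 3)"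
  proof
    assume grid: "index_grid X r M (2 * w + 3)"
    obtain W0 where W0: "finite W0" "W0 \<subseteq> X"
      "\<And>W. W0 \<subseteq> W \<Longrightarrow> W \<subseteq> X \<Longrightarrow> \<exists>f g. index_map W r f \<and> index_map W r g \<and>
         f ` W = {..<2 * w + 3} \<and> g ` W = {..<2 * w + 3} \<and>
         {..<2 * w + 3} \<times> {..<2 * w + 3} \<subseteq> index_ones M f g W W"
      by (rule index_grid_total[OF lin grid]) auto
    \<comment> \<open>For finite \<open>X\<close> the invariant is computed on \<open>X\<close>
      itself and not as a supremum over submatrices, so the grid has to be spread over all of
      \<open>X\<close>.\<close>
    define W where "W = (if finite X then X else W0)"
    have W: "finite W" "W0 \<subseteq> W" "W \<subseteq> X" unfolding W_def using W0 by auto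
    have "finite_matrix_stww W r W r M \<le> matrix_stww X r X r M"
      unfolding matrix_stww_def W_def using W0 by (auto intro!: SUP_upper2[of "(W0, W0)"])
    also have "\<dots> < enat w" unfolding w' w_def by simp
    finally obtain Ds where Ds: "division_sequence W r W r Ds" "(SUP D\<in>set Ds. division_width M D) < enat w"
      unfolding finite_matrix_stww_def INF_less_iff by auto
    have wd: "division_width M D \<le> enat w" if "D \<in> set Ds" for D
      using SUP_upper[OF that, of "division_width M"] Ds(2) by simp
    obtain f g where "index_map W r f" "f ` W = {..<2 * w + 3}"
      "index_map W r g" "g ` W = {..<2 * w + 3}"
      "{..<2 * w + 3} \<times> {..<2 * w + 3} \<subseteq> index_ones M f g W W"
      using W0(3)[OF W(2,3)] by blast
    from matrix_grid_bound[OF lin W(3,3,1,1) this Ds(1) wd] have "2 * w + 3 \<le> 2 * w + 2" by simp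
    then show False by simp
  qed
  show ?thesis by (rule index_grid_free_sparse[OF _ no]) simp
qed

section \<open>Orders adapted to a partition sequence\<close>

text \<open>
  Each part is listed so that all parts merged into it occupy consecutive positions; merging
  two parts concatenates their lists.
\<close>
lemma merge_chain_lists:
  assumes "Ps \<noteq> []" "successively merges Ps" "\<forall>P\<in>set Ps. partition_on V P" "hd Ps = singleton_parts V"
  shows "\<exists>L. (\<forall>A\<in>last Ps. set (L A) = A \<and> distinct (L A)) \<and>
    (\<forall>P\<in>set Ps. \<forall>C\<in>P. \<exists>A\<in>last Ps. \<exists>u v w. L A = u @ v @ w \<and> set v = C)"
  using assms
proof (induction Ps rule: rev_nonempty_induct)
  case (single P)
  have A: "set [the_elem A] = A" if "A \<in> P" for A
    using that single unfolding singleton_parts_def by auto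
  have "[the_elem A] = [] @ [the_elem A] @ []" for A :: "'a set" by simp
  with A have "\<exists>u v w. [the_elem A] = u @ v @ w \<and> set v = A" if "A \<in> P" for A
    using that by blast
  with A have "\<forall>C\<in>P. \<exists>A\<in>P. \<exists>u v w. [the_elem A] = u @ v @ w \<and> set v = C" by blast
  with A show ?case by (intro exI[of _ "\<lambda>A. [the_elem A]"]) simp
next
  case (snoc Q Ps)
  define P where "P = last Ps"
  have PPs: "P \<in> set Ps" unfolding P_def using snoc.hyps by simp
  have succ: "successively merges Ps" "merges P Q"
    using snoc.prems(1) snoc.hyps unfolding successively_append_iff P_def by auto
  have "\<exists>L. (\<forall>A\<in>P. set (L A) = A \<and> distinct (L A)) \<and>
    (\<forall>R\<in>set Ps. \<forall>C\<in>R. \<exists>A\<in>P. \<exists>u v w. L A = u @ v @ w \<and> set v = C)"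
    unfolding P_def using snoc.prems(2,3) snoc.hyps succ(1) by (intro snoc.IH) auto
  then obtain L where L_all: "\<forall>A\<in>P. set (L A) = A \<and> distinct (L A)"
    "\<forall>R\<in>set Ps. \<forall>C\<in>R. \<exists>A\<in>P. \<exists>u v w. L A = u @ v @ w \<and> set v = C"
    by (elim exE conjE)
  have L: "set (L A) = A \<and> distinct (L A)" if "A \<in> P" for A using L_all(1) that by blast
  have seg: "\<exists>A\<in>P. \<exists>u v w. L A = u @ v @ w \<and> set v = C" if "R \<in> set Ps" "C \<in> R" for R C
    using bspec[OF bspec[OF L_all(2) that(1)] that(2)] .
  obtain A B where AB: "A \<in> P" "B \<in> P" "A \<noteq> B" "Q = insert (A \<union> B) (P - {A, B})"
    using succ(2) unfolding merges_def by blast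
  have "partition_on V P" using snoc.prems(2) PPs by simp
  then have disj: "\<And>C D. C \<in> P \<Longrightarrow> D \<in> P \<Longrightarrow> C \<noteq> D \<Longrightarrow> C \<inter> D = {}" and ne: "{} \<notin> P"
    unfolding partition_on_def by (auto dest: disjointD)
  define L' where "L' = L(A \<union> B := L A @ L B)"
  \<comment> \<open>The update at \<open>A \<union> B\<close> must not overwrite the list of another
    part; disjointness and nonemptiness exclude this.\<close>
  have old: "L' C = L C" if "C \<in> P" "C \<noteq> A" "C \<noteq> B" for C
  proof -
    have "C \<noteq> A \<union> B" using disj[of C A] AB(1) ne that by auto
    then show ?thesis unfolding L'_def by simp
  qed
  have new: "L' (A \<union> B) = L A @ L B" unfolding L'_def by simp
  have L'1: "set (L' C) = C \<and> distinct (L' C)" if "C \<in> Q" for C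
  proof (cases "C = A \<union> B")
    case True
    then show ?thesis using L[OF AB(1)] L[OF AB(2)] disj[OF AB(1-3)] new by simp
  next
    case False
    then show ?thesis using that old L unfolding AB(4) by auto
  qed
  have "\<exists>D\<in>Q. \<exists>u v w. L' D = u @ v @ w \<and> set v = C"
    if R: "R \<in> set (Ps @ [Q])" and C: "C \<in> R" for R C
  proof (cases "R \<in> set Ps")
    case True
    obtain D u v w where D: "D \<in> P" "L D = u @ v @ w" "set v = C"
      using seg[OF True C] by blast
    consider "D = A" | "D = B" | "D \<noteq> A" "D \<noteq> B" by blast
    then show ?thesis
    proof cases
      case 1
      then have "L' (A \<union> B) = u @ v @ (w @ L B)" using D(2) new by simp
      then show ?thesis using D(3) AB(4) by blast
    next
      case 2
      then have "L' (A \<union> B) = (L A @ u) @ v @ w" using D(2) new by simp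
      then show ?thesis using D(3) AB(4) by blast
    next
      case 3
      then have "L' D = u @ v @ w" "D \<in> Q" using D old AB(4) by auto
      then show ?thesis using D(3) by blast
    qed
  next
    case False
    then have "C \<in> Q" using R C by simp
    moreover have "L' C = [] @ L' C @ []" by simp
    ultimately show ?thesis using L'1 by blast
  qed
  then show ?case using L'1 by (intro exI[of _ L']) simp
qed

lemma list_order:
  assumes "distinct l" "set l = V"
  obtains r where "linear_order_on V r" "\<And>u v w. l = u @ v @ w \<Longrightarrow> interval_on V r (set v)"
proof -
  define pos where "pos = inv_into {..<length l} ((!) l)"
  have inj: "inj_on ((!) l) {..<length l}" using assms(1) by (intro inj_on_nth) auto
  have pos: "pos (l ! i) = i" if "i < length l" for i
    unfolding pos_def using inj that by (simp add: inv_into_f_f)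
  have nth: "\<exists>i<length l. x = l ! i" if "x \<in> V" for x
    using that assms(2) by (metis in_set_conv_nth)
  have pos_inj: "x = y" if "x \<in> V" "y \<in> V" "pos x = pos y" for x y
    using nth[OF that(1)] nth[OF that(2)] that(3) pos by auto
  define r where "r = {(x, y). x \<in> V \<and> y \<in> V \<and> pos x \<le> pos y}"
  show thesis
  proof (rule that)
    show "linear_order_on V r"
      unfolding order_on_defs refl_on_def trans_def antisym_def total_on_def r_def
      using pos_inj by auto
    fix u v w assume l: "l = u @ v @ w"
    have "set v = {x \<in> V. pos x \<in> {length u..<length u + length v}}"
    proof (intro equalityI subsetI)
      fix x assume "x \<in> set v"
      then obtain j where j: "j < length v" "x = v ! j" by (auto simp: in_set_conv_nth)
      then have "x = l ! (length u + j)" "length u + j < length l"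
        unfolding l by (simp_all add: nth_append)
      then have "pos x = length u + j" using pos by simp
      moreover have "x \<in> V" using \<open>x \<in> set v\<close> assms(2) unfolding l by auto
      ultimately show "x \<in> {x \<in> V. pos x \<in> {length u..<length u + length v}}" using j(1) by simp
    next
      fix x assume x: "x \<in> {x \<in> V. pos x \<in> {length u..<length u + length v}}"
      then obtain i where i: "i < length l" "x = l ! i" using nth by blast
      then have "length u \<le> i" "i < length u + length v" using x pos by auto
      then have "x = v ! (i - length u)" "i - length u < length v"
        using i(2) unfolding l by (auto simp: nth_append)
      then show "x \<in> set v" by simp
    qed
    moreover have "index_map V r pos" unfolding r_def by (auto simp: monotone_on_def)
    ultimately show "interval_on V r (set v)"
      using index_map_interval[of V r pos "{length u..<length u + length v}"] by auto
  qed
qed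

lemma partition_sequence_order:
  assumes "partition_sequence V Ps"
  obtains r where "linear_order_on V r" "\<forall>P\<in>set Ps. \<forall>A\<in>P. interval_on V r A"
proof (cases "V = {}")
  \<comment> \<open>For empty \<open>V\<close> the last partition has no part whose list could be
    used.\<close>
  case True
  have "A = {}" if "P \<in> set Ps" "A \<in> P" for P A
    using assms that True unfolding partition_sequence_def partition_on_def by blast
  then show thesis using that[of "{}"] True by (auto simp: interval_on_def)
next
  case False
  then have last: "last Ps = {V}" using assms unfolding partition_sequence_def one_part_def by auto
  have "\<exists>L. (\<forall>A\<in>last Ps. set (L A) = A \<and> distinct (L A)) \<and>
      (\<forall>P\<in>set Ps. \<forall>C\<in>P. \<exists>A\<in>last Ps. \<exists>u v w. L A = u @ v @ w \<and> set v = C)"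
    using assms unfolding partition_sequence_def by (intro merge_chain_lists) auto
  then obtain L where L: "set (L V) = V" "distinct (L V)"
    and seg: "\<And>P C. P \<in> set Ps \<Longrightarrow> C \<in> P \<Longrightarrow> \<exists>u v w. L V = u @ v @ w \<and> set v = C"
    unfolding last by auto
  show thesis
  proof (rule list_order[OF L(2,1)])
    fix r
    assume lin: "linear_order_on V r"
      and int: "\<And>u v w. L V = u @ v @ w \<Longrightarrow> interval_on V r (set v)"
    have "interval_on V r A" if "P \<in> set Ps" "A \<in> P" for P A
    proof -
      obtain u v w where "L V = u @ v @ w" "set v = A" using seg[OF \<open>P \<in> set Ps\<close> \<open>A \<in> P\<close>] by blast
      then show ?thesis using int by blast
    qed
    then show thesis using that lin by blast
  qed
qed

text \<open>Here one merge changes rows and columns at once, so at the first failure the new part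
  may meet up to \<open>2 + 2\<close> classes of either labelling; this is the factor 4. The
  quotient graph ignores a part joined to itself, so degrees are bounded by \<open>w + 1\<close>,
  whence \<open>4 * (w + 1)\<close>.\<close>

lemma graph_grid_bound:
  assumes sym: "\<And>x y. x \<in> W \<Longrightarrow> y \<in> W \<Longrightarrow> E x y \<Longrightarrow> E y x" and lin: "linear_order_on W r" and W: "finite W"
    and seq: "partition_sequence W Ps" "\<And>P. P \<in> set Ps \<Longrightarrow> quotient_max_degree E P \<le> enat w"
    and int: "\<And>P A. P \<in> set Ps \<Longrightarrow> A \<in> P \<Longrightarrow> interval_on W r A"
    and grid: "index_grid W r E k"
  shows "k \<le> 4 * w + 4"
proof (cases "k \<ge> 3")
  case True
  obtain f g where f: "index_map W r f" "f ` W = {..<k}" and g: "index_map W r g" "g ` W = {..<k}"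
    and ones: "{..<k} \<times> {..<k} \<subseteq> index_ones E f g W W"
    by (rule index_grid_onto[OF lin grid]) (use True in auto)
  define good where "good P \<longleftrightarrow> (\<forall>A\<in>P. card (f ` A) \<le> 2 \<and> card (g ` A) \<le> 2)" for P
  have "good (hd Ps)" using seq(1) card_image_singleton_parts
    unfolding partition_sequence_def good_def by auto
  moreover have "\<not> good (last Ps)" using seq(1) card_image_one_part[OF f(2) True]
    unfolding partition_sequence_def good_def by auto
  ultimately obtain P P' where PP': "P' \<in> set Ps" "merges P P'" "good P" "\<not> good P'"
    using successively_first_failure[of merges Ps good] seq(1)
    unfolding partition_sequence_def by blast
  have part: "partition_on W P'" using seq(1) PP'(1) unfolding partition_sequence_def by auto
  have fin: "finite P'" using finite_elements[OF W part] .
  obtain A B where AB: "A \<in> P" "B \<in> P" "P' = insert (A \<union> B) (P - {A, B})"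
    using PP'(2) unfolding merges_def by blast
  have un: "card (h ` (A \<union> B)) \<le> card (h ` A) + card (h ` B)" for h :: "'a \<Rightarrow> nat"
    unfolding image_Un by (rule card_Un_le)
  have "card (f ` C) \<le> 4 \<and> card (g ` C) \<le> 4" if "C \<in> P'" for C
  proof (cases "C = A \<union> B")
    case True
    have "card (f ` A) \<le> 2" "card (f ` B) \<le> 2" "card (g ` A) \<le> 2" "card (g ` B) \<le> 2"
      using PP'(3) AB(1,2) unfolding good_def by auto
    then show ?thesis using un[of f] un[of g] unfolding True by linarith
  next
    case False
    then have "C \<in> P" using that AB(3) by auto
    then show ?thesis using PP'(3) unfolding good_def by fastforce
  qed
  then have small: "\<And>C. C \<in> P' \<Longrightarrow> card (f ` C) \<le> 4" "\<And>C. C \<in> P' \<Longrightarrow> card (g ` C) \<le> 4" by blast+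
  have deg: "quotient_degree E P' I \<le> w + 1" if "I \<in> P'" for I
  proof -
    have "enat (card {B \<in> P'. quotient_graph_adj E I B}) \<le> quotient_max_degree E P'"
      unfolding quotient_max_degree_def using that by (rule SUP_upper)
    then have "card {B \<in> P'. quotient_graph_adj E I B} \<le> w"
      using seq(2)[OF PP'(1)] by (meson enat_ord_simps(1) order_trans)
    moreover have "{B \<in> P'. quotient_entry E I B} \<subseteq> insert I {B \<in> P'. quotient_graph_adj E I B}"
      unfolding quotient_entry_def quotient_graph_adj_def by auto
    then have "card {B \<in> P'. quotient_entry E I B} \<le> card (insert I {B \<in> P'. quotient_graph_adj E I B})"
      using fin by (intro card_mono) auto
    moreover have "card (insert I {B \<in> P'. quotient_graph_adj E I B})
        \<le> Suc (card {B \<in> P'. quotient_graph_adj E I B})"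
      by (rule card_insert_le_m1) simp_all
    ultimately show ?thesis unfolding quotient_degree_def by simp
  qed
  have "\<exists>I\<in>P'. card (f ` I) \<ge> 3 \<or> card (g ` I) \<ge> 3"
    using PP'(4) unfolding good_def by fastforce
  then obtain I where I: "I \<in> P'" "card (f ` I) \<ge> 3 \<or> card (g ` I) \<ge> 3" by blast
  have "k \<le> 4 * quotient_degree E P' I"
    using I(2)
  proof
    assume "card (f ` I) \<ge> 3"
    then show ?thesis
      by (rule big_interval_degree[OF lin order_refl f ones int[OF PP'(1) I(1)] _ part W small(2)])
  next
    have ones': "{..<k} \<times> {..<k} \<subseteq> index_ones E g f W W"
      using ones sym unfolding index_ones_def by fast
    assume "card (g ` I) \<ge> 3"
    then show ?thesis
      by (rule big_interval_degree[OF lin order_refl g ones' int[OF PP'(1) I(1)] _ part W small(1)])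
  qed
  then show ?thesis using deg[OF I(1)] by linarith
qed simp

section \<open>Compactness of linear orders\<close>

lemma linear_order_on_restrict:
  assumes "linear_order_on X r" "W \<subseteq> X"
  shows "linear_order_on W (r \<inter> W \<times> W)"
proof -
  note r = linear_order_onD[OF assms(1)]
  have "refl_on W (r \<inter> W \<times> W)" using r(1) assms(2) by (auto intro: refl_onI)
  moreover have "trans (r \<inter> W \<times> W)" by (rule transI) (use r(3) in blast)
  moreover have "antisym (r \<inter> W \<times> W)" by (rule antisymI) (use r(4) in blast)
  moreover have "total_on W (r \<inter> W \<times> W)" by (rule total_onI) (use r(2) assms(2) in blast)
  ultimately show ?thesis unfolding order_on_defs by blast
qed

text \<open>The set is a finite union of cylinders, one for each admissible trace on
  \<open>F\<close>, and each cylinder is a finite intersection of closed conditions on single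
  coordinates.\<close>

lemma closedin_finite_coordinates:
  fixes \<phi> :: "'i set \<Rightarrow> bool"
  defines "T \<equiv> product_topology (\<lambda>_. discrete_topology (UNIV :: bool set)) UNIV"
  assumes "finite F"
  shows "closedin T {\<chi>. \<phi> {p \<in> F. \<chi> p}}"
proof -
  have top: "topspace T = UNIV" unfolding T_def by simp
  have coord: "closedin T {\<chi>. \<chi> p = b}" for p b
  proof -
    have "continuous_map T (discrete_topology UNIV) (\<lambda>\<chi>. \<chi> p)"
      unfolding T_def using continuous_map_product_projection[of p UNIV "\<lambda>_. discrete_topology UNIV"]
      by simp
    from closedin_continuous_map_preimage[OF this, of "{b}"] show ?thesis by (simp add: top)
  qed
  have fib: "closedin T {\<chi>. {p \<in> F. \<chi> p} = G}" if "G \<subseteq> F" for G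
  proof -
    \<comment> \<open>Adding the whole space keeps the intersected family nonempty when
      \<open>F\<close> is empty.\<close>
    have "{\<chi>. {p \<in> F. \<chi> p} = G} = \<Inter> (insert (topspace T) ((\<lambda>p. {\<chi>. \<chi> p = (p \<in> G)}) ` F))"
      using that by (auto simp: top)
    also have "closedin T \<dots>" using coord by (intro closedin_Inter) auto
    finally show ?thesis .
  qed
  have "{\<chi>. \<phi> {p \<in> F. \<chi> p}} = (\<Union>G\<in>{G. G \<subseteq> F \<and> \<phi> G}. {\<chi>. {p \<in> F. \<chi> p} = G})" by auto
  also have "closedin T \<dots>"
    using assms(2) fib by (intro closedin_Union) auto
  finally show ?thesis .
qed

text \<open>
  The relations whose restriction to a given finite \<open>W\<close> is good form a closed set in the product
  space of all relations, which is compact by Tychonoff's theorem.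
\<close>
lemma linear_order_compactness:
  assumes ex: "\<And>W. finite W \<Longrightarrow> W \<subseteq> X \<Longrightarrow> \<exists>r. linear_order_on W r \<and> Q W r"
    and mono: "\<And>W W' r. linear_order_on W r \<Longrightarrow> Q W r \<Longrightarrow> W' \<subseteq> W \<Longrightarrow> Q W' (r \<inter> W' \<times> W')"
  obtains r where "linear_order_on X r" "\<forall>W. finite W \<longrightarrow> W \<subseteq> X \<longrightarrow> Q W (r \<inter> W \<times> W)"
proof -
  define T where "T = product_topology (\<lambda>_ :: 'a \<times> 'a. discrete_topology (UNIV :: bool set)) UNIV"
  define K where "K W = {\<chi>. linear_order_on W {p \<in> W \<times> W. \<chi> p} \<and> Q W {p \<in> W \<times> W. \<chi> p}}" for W
  define \<U> where "\<U> = K ` {W. finite W \<and> W \<subseteq> X}"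
  have "compact_space T"
    unfolding T_def compact_space_product_topology by (simp add: compact_space_discrete_topology)
  moreover have "closedin T C" if "C \<in> \<U>" for C
  proof -
    from that obtain W where W: "C = K W" "finite W" unfolding \<U>_def by auto
    then show ?thesis unfolding T_def W(1) K_def
      by (intro closedin_finite_coordinates[of "W \<times> W" "\<lambda>r. linear_order_on W r \<and> Q W r"]) simp
  qed
  moreover have "\<Inter> \<F> \<noteq> {}" if \<F>: "finite \<F>" "\<F> \<subseteq> \<U>" for \<F>
  proof -
    obtain N where N: "N \<subseteq> {W. finite W \<and> W \<subseteq> X}" "finite N" "\<F> = K ` N"
      using finite_subset_image[OF \<F>[unfolded \<U>_def]] by blast
    then have "finite (\<Union> N)" "\<Union> N \<subseteq> X" by auto
    then obtain r where r: "linear_order_on (\<Union> N) r" "Q (\<Union> N) r" using ex by blast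
    have "(\<lambda>p. p \<in> r) \<in> K W" if "W \<in> N" for W
    proof -
      have sub: "W \<subseteq> \<Union> N" using that by blast
      have "{p \<in> W \<times> W. p \<in> r} = r \<inter> W \<times> W" by auto
      then show ?thesis unfolding K_def
        using linear_order_on_restrict[OF r(1) sub] mono[OF r sub] by simp
    qed
    then show ?thesis unfolding N(3) by blast
  qed
  ultimately have "\<Inter> \<U> \<noteq> {}" unfolding compact_space_fip by blast
  then obtain \<chi> where \<chi>: "\<And>W. finite W \<Longrightarrow> W \<subseteq> X \<Longrightarrow> \<chi> \<in> K W" unfolding \<U>_def by auto
  define r where "r = {p \<in> X \<times> X. \<chi> p}"
  have W: "linear_order_on W (r \<inter> W \<times> W) \<and> Q W (r \<inter> W \<times> W)" if "finite W" "W \<subseteq> X" for W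
  proof -
    have "r \<inter> W \<times> W = {p \<in> W \<times> W. \<chi> p}" unfolding r_def using that(2) by auto
    then show ?thesis using \<chi>[OF that] unfolding K_def by simp
  qed
  \<comment> \<open>Each axiom of a linear order involves at most three points, so it can be read
    off from the restriction to a finite set.\<close>
  have "linear_order_on X r"
    unfolding order_on_defs
  proof (intro conjI)
    show "r \<subseteq> X \<times> X" unfolding r_def by auto
    show "refl_on X r"
    proof (rule refl_onI)
      fix x assume "x \<in> X"
      then have "linear_order_on {x} (r \<inter> {x} \<times> {x})" using W[of "{x}"] by simp
      from linear_order_onD(1)[OF this, of x] show "(x, x) \<in> r" by simp
    qed
    show "trans r"
    proof (rule transI)
      fix x y z assume xyz: "(x, y) \<in> r" "(y, z) \<in> r"
      let ?W = "{x, y, z}"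
      have "?W \<subseteq> X" using xyz unfolding r_def by auto
      then have "linear_order_on ?W (r \<inter> ?W \<times> ?W)" using W[of ?W] by simp
      from linear_order_onD(3)[OF this, of x y z] show "(x, z) \<in> r" using xyz by simp
    qed
    show "antisym r"
    proof (rule antisymI)
      fix x y assume xy: "(x, y) \<in> r" "(y, x) \<in> r"
      let ?W = "{x, y}"
      have "?W \<subseteq> X" using xy unfolding r_def by auto
      then have "linear_order_on ?W (r \<inter> ?W \<times> ?W)" using W[of ?W] by simp
      from linear_order_onD(4)[OF this, of x y] show "x = y" using xy by simp
    qed
    show "total_on X r"
    proof (rule total_onI)
      fix x y assume "x \<in> X" "y \<in> X"
      let ?W = "{x, y}"
      have "linear_order_on ?W (r \<inter> ?W \<times> ?W)" using W[of ?W] \<open>x \<in> X\<close> \<open>y \<in> X\<close> by simp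
      from linear_order_onD(2)[OF this, of x y] show "(x, y) \<in> r \<or> (y, x) \<in> r" by auto
    qed
  qed
  then show thesis using that W by blast
qed

section \<open>Finite character of grids\<close>

lemma index_grid_restrict:
  assumes "index_grid W' (r \<inter> W' \<times> W') M k" "W' \<subseteq> W"
  shows "index_grid W r M k"
proof -
  obtain A B f g where AB: "finite A" "finite B" "A \<subseteq> W'" "B \<subseteq> W'"
    "index_map A (r \<inter> W' \<times> W') f" "index_map B (r \<inter> W' \<times> W') g"
    "{..<k} \<times> {..<k} \<subseteq> index_ones M f g A B"
    using assms(1) unfolding index_grid_def by blast
  have "index_map A r f" "index_map B r g"
    using AB(3-6) by (auto simp: monotone_on_def subset_iff)
  moreover have "A \<subseteq> W" "B \<subseteq> W" using AB(3,4) assms(2) by auto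
  ultimately show ?thesis using AB unfolding index_grid_def by blast
qed

text \<open>The witnesses of a grid are finite, so an order that is grid-free on every finite subset
  is grid-free on \<open>X\<close>.\<close>

lemma index_grid_finite_part:
  assumes "index_grid X r M k"
  obtains W where "finite W" "W \<subseteq> X" "index_grid W (r \<inter> W \<times> W) M k"
proof -
  obtain A B f g where AB: "finite A" "finite B" "A \<subseteq> X" "B \<subseteq> X"
    "index_map A r f" "index_map B r g" "{..<k} \<times> {..<k} \<subseteq> index_ones M f g A B"
    using assms unfolding index_grid_def by blast
  let ?r = "r \<inter> (A \<union> B) \<times> (A \<union> B)"
  have "index_map A ?r f" "index_map B ?r g" using AB(5,6) by (auto simp: monotone_on_def)
  then have "index_grid (A \<union> B) ?r M k" unfolding index_grid_def
    using AB by (intro exI[of _ A] exI[of _ B] exI[of _ f] exI[of _ g]) auto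
  then show thesis using AB that[of "A \<union> B"] by simp
qed

theorem graph_stww_finite_sparse:
  assumes sym: "\<And>x y. x \<in> X \<Longrightarrow> y \<in> X \<Longrightarrow> E x y \<Longrightarrow> E y x" and fin: "graph_stww X E < \<infinity>"
  shows "\<exists>r c. linear_order_on X r \<and> sparse X r E c"
proof -
  obtain w' where w': "graph_stww X E = enat w'" using fin by auto
  define w where "w = Suc w'"
  define k where "k = 4 * w + 5"
  have bounded: "\<exists>r. linear_order_on W r \<and> \<not> index_grid W r E k"
    if W: "finite W" "W \<subseteq> X" and le: "finite_graph_stww W E \<le> graph_stww X E" for W
  proof -
    have "finite_graph_stww W E < enat w" using le unfolding w' w_def by (rule le_less_trans) simp
    then obtain Ps where Ps: "partition_sequence W Ps" "(SUP P\<in>set Ps. quotient_max_degree E P) < enat w"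
      unfolding finite_graph_stww_def INF_less_iff by auto
    have deg: "quotient_max_degree E P \<le> enat w" if "P \<in> set Ps" for P
      using SUP_upper[OF that, of "quotient_max_degree E"] Ps(2) by simp
    obtain r where r: "linear_order_on W r" "\<forall>P\<in>set Ps. \<forall>A\<in>P. interval_on W r A"
      by (rule partition_sequence_order[OF Ps(1)])
    have int: "\<And>P A. P \<in> set Ps \<Longrightarrow> A \<in> P \<Longrightarrow> interval_on W r A" using r(2) by blast
    have symW: "\<And>x y. x \<in> W \<Longrightarrow> y \<in> W \<Longrightarrow> E x y \<Longrightarrow> E y x" using sym W(2) by blast
    have "\<not> index_grid W r E k"
    proof
      assume "index_grid W r E k"
      from graph_grid_bound[OF symW r(1) W(1) Ps(1) deg int this] show False unfolding k_def by simp
    qed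
    then show ?thesis using r(1) by blast
  qed
  have ex: "\<exists>r. linear_order_on W r \<and> \<not> index_grid W r E k" if W: "finite W" "W \<subseteq> X" for W
  proof (cases "finite X")
    \<comment> \<open>For finite \<open>X\<close> only the twin-width of \<open>X\<close> itself is
      given. An order is found there and restricted, which spares comparing twin-widths of
      subgraphs.\<close>
    case True
    obtain r where r: "linear_order_on X r" "\<not> index_grid X r E k"
      using bounded[OF True order_refl] True unfolding graph_stww_def by auto
    have "\<not> index_grid W (r \<inter> W \<times> W) E k" using index_grid_restrict[OF _ W(2)] r(2) by blast
    then show ?thesis using linear_order_on_restrict[OF r(1) W(2)] by blast
  next
    case False
    have "finite_graph_stww W E \<le> graph_stww X E"
      using False W unfolding graph_stww_def by (auto intro!: SUP_upper)
    then show ?thesis by (rule bounded[OF W])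
  qed
  have mono: "\<not> index_grid W' (r \<inter> W' \<times> W') E k" if "\<not> index_grid W r E k" "W' \<subseteq> W" for W W' r
    using index_grid_restrict[OF _ that(2)] that(1) by blast
  obtain r where r: "linear_order_on X r"
    "\<forall>W. finite W \<longrightarrow> W \<subseteq> X \<longrightarrow> \<not> index_grid W (r \<inter> W \<times> W) E k"
    by (rule linear_order_compactness[of X "\<lambda>W r. \<not> index_grid W r E k", OF ex mono])
  have no: "\<not> index_grid X r E k"
  proof
    assume "index_grid X r E k"
    then obtain W where W: "finite W" "W \<subseteq> X" "index_grid W (r \<inter> W \<times> W) E k"
      by (rule index_grid_finite_part)
    from r(2)[rule_format, OF W(1,2)] W(3) show False ..
  qed
  have "\<exists>c. sparse X r E c" by (rule index_grid_free_sparse[OF _ no]) (simp add: k_def)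
  then show ?thesis using r(1) by blast
qed

section \<open>Cayley graphs and right multiplication\<close>

text \<open>A 2-grid on the diagonal would give two points that one labelling orders one way and the
  other labelling the opposite way, although both are monotone for the same order.\<close>

lemma sparse_eq:
  assumes "linear_order_on X r"
  shows "\<exists>c. sparse X r (=) c"
proof -
  have no: "\<not> index_grid X r (=) 2"
  proof
    assume grid: "index_grid X r (=) 2"
    obtain f g where f: "index_map X r f" and g: "index_map X r g"
      and ones: "{..<2} \<times> {..<2} \<subseteq> index_ones (=) f g X X"
      by (rule index_grid_onto[OF assms grid]) auto
    have "(0, 1) \<in> index_ones (=) f g X X" "(1, 0) \<in> index_ones (=) f g X X" using ones by auto
    then obtain x y where xy: "x \<in> X" "f x = 0" "g x = 1" "y \<in> X" "f y = 1" "g y = 0"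
      unfolding index_ones_def by auto
    then show False
      using linear_order_onD(2)[OF assms, of x y] monotone_onD[OF f, of y x] monotone_onD[OF g, of x y]
      by auto
  qed
  show ?thesis by (rule index_grid_free_sparse[OF _ no]) simp
qed

context group
begin

lemma cayley_adj_sym:
  assumes S: "S \<subseteq> carrier G" and xy: "x \<in> carrier G" "y \<in> carrier G" and "cayley_adj G S x y"
  shows "cayley_adj G S y x"
proof -
  have "inv y \<otimes> x = inv (inv x \<otimes> y)" using xy by (simp add: inv_mult_group)
  moreover have "inv z \<in> S \<union> (\<lambda>s. inv s) ` S" if "z \<in> S \<union> (\<lambda>s. inv s) ` S" for z
    using that S by auto
  ultimately show ?thesis using assms(4) unfolding cayley_adj_def by auto
qed

lemma card_cayley_neighbours:
  assumes S: "finite S" "S \<subseteq> carrier G" and V: "V \<subseteq> carrier G" and x: "x \<in> carrier G"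
  shows "card {y \<in> V. cayley_adj G S x y} \<le> card (S \<union> (\<lambda>s. inv s) ` S)"
proof -
  have "{y \<in> V. cayley_adj G S x y} \<subseteq> (\<lambda>s. x \<otimes> s) ` (S \<union> (\<lambda>s. inv s) ` S)"
  proof
    fix y assume y: "y \<in> {y \<in> V. cayley_adj G S x y}"
    then have "y = x \<otimes> (inv x \<otimes> y)" using x V by (auto simp: m_assoc[symmetric])
    then show "y \<in> (\<lambda>s. x \<otimes> s) ` (S \<union> (\<lambda>s. inv s) ` S)"
      using y unfolding cayley_adj_def by blast
  qed
  then have "card {y \<in> V. cayley_adj G S x y} \<le> card ((\<lambda>s. x \<otimes> s) ` (S \<union> (\<lambda>s. inv s) ` S))"
    using S by (intro card_mono) auto
  also have "\<dots> \<le> card (S \<union> (\<lambda>s. inv s) ` S)" using S by (intro card_image_le) auto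
  finally show ?thesis .
qed

lemma sparse_right_mult_one:
  assumes "linear_order_on (carrier G) r"
  shows "\<exists>c. sparse (carrier G) r (right_mult_matrix G \<one>) c"
proof -
  obtain c where "sparse (carrier G) r (=) c" using sparse_eq[OF assms] by blast
  then have "sparse (carrier G) r (right_mult_matrix G \<one>) c"
    by (rule sparse_mono) (simp add: right_mult_matrix_def)
  then show ?thesis by blast
qed

lemma sparse_right_mult_mult:
  assumes lin: "linear_order_on (carrier G) r" and gh: "g \<in> carrier G" "h \<in> carrier G"
    and "\<exists>c. sparse (carrier G) r (right_mult_matrix G g) c"
    and "\<exists>c. sparse (carrier G) r (right_mult_matrix G h) c"
  shows "\<exists>c. sparse (carrier G) r (right_mult_matrix G (g \<otimes> h)) c"
proof -
  obtain c where c: "sparse (carrier G) r (\<lambda>x y. x \<otimes> g = y) c"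
    using assms(4) unfolding right_mult_matrix_def by blast
  obtain d where d: "sparse (carrier G) r (\<lambda>x y. x \<otimes> h = y) d"
    using assms(5) unfolding right_mult_matrix_def by blast
  have "inj_on (\<lambda>x. x \<otimes> g) (carrier G)" "(\<lambda>x. x \<otimes> g) ` carrier G \<subseteq> carrier G"
    using gh(1) by (auto simp: inj_on_def)
  from sparse_comp[OF lin this c d]
  have "sparse (carrier G) r (right_mult_matrix G (g \<otimes> h)) (2 * (c + d + 1) ^ 3)"
    by (rule sparse_mono) (use gh in \<open>simp add: right_mult_matrix_def m_assoc\<close>)
  then show ?thesis by blast
qed

text \<open>Off the diagonal, adjacency is the union of the finitely many \<open>M_s\<close> with
  \<open>s\<close> a generator or the inverse of one. Domination passes from the graph to each
  \<open>M_s\<close>, union leads back, and composition reaches every word in the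
  generators.\<close>

lemma sparse_cayley_iff:
  assumes lin: "linear_order_on (carrier G) r" and S: "finite_generating_set G S"
  shows "(\<exists>c. sparse (carrier G) r (cayley_adj G S) c) \<longleftrightarrow>
    (\<forall>g\<in>carrier G. \<exists>c. sparse (carrier G) r (right_mult_matrix G g) c)"
proof
  have sub: "finite S" "S \<subseteq> carrier G" and gen: "generate G S = carrier G"
    using S unfolding finite_generating_set_def by auto
  let ?T = "S \<union> (\<lambda>s. inv s) ` S"
  show "\<forall>g\<in>carrier G. \<exists>c. sparse (carrier G) r (right_mult_matrix G g) c"
    if "\<exists>c. sparse (carrier G) r (cayley_adj G S) c"
  proof
    from that obtain c where c: "sparse (carrier G) r (cayley_adj G S) c" ..
    \<comment> \<open>A simple graph has no loops, so an identity element among the generators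
      leaves no trace in the adjacency matrix; the diagonal is sparse by itself.\<close>
    have gens: "\<exists>c. sparse (carrier G) r (right_mult_matrix G s) c" if s: "s \<in> ?T" for s
    proof (cases "s = \<one>")
      case False
      have sG: "s \<in> carrier G" using s sub by auto
      have "cayley_adj G S x y"
        if "x \<in> carrier G" "y \<in> carrier G" "right_mult_matrix G s x y" for x y
      proof -
        have y: "y = x \<otimes> s" using that(3) unfolding right_mult_matrix_def by simp
        then have "inv x \<otimes> y = s" using that(1) sG by (simp add: m_assoc[symmetric])
        moreover have "x \<noteq> y" using y that(1) sG False by (metis l_cancel_one')
        ultimately show ?thesis using s unfolding cayley_adj_def by simp
      qed
      with c have "sparse (carrier G) r (right_mult_matrix G s) c" by (rule sparse_mono)
      then show ?thesis by blast
    qed (use sparse_right_mult_one[OF lin] in simp)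
    fix g assume "g \<in> carrier G"
    then have "g \<in> generate G S" using gen by simp
    then show "\<exists>c. sparse (carrier G) r (right_mult_matrix G g) c"
    proof (induction rule: generate.induct)
      case one
      show ?case by (rule sparse_right_mult_one[OF lin])
    next
      case (incl h)
      then show ?case by (intro gens) simp
    next
      case (inv h)
      then show ?case by (intro gens) simp
    next
      case (eng h1 h2)
      then show ?case using gen by (intro sparse_right_mult_mult[OF lin]) auto
    qed
  qed
  show "\<exists>c. sparse (carrier G) r (cayley_adj G S) c"
    if all: "\<forall>g\<in>carrier G. \<exists>c. sparse (carrier G) r (right_mult_matrix G g) c"
  proof -
    have "\<exists>c. sparse (carrier G) r (\<lambda>x y. \<exists>s\<in>?T. right_mult_matrix G s x y) c"
    proof (rule sparse_Bex)
      show "finite ?T" using sub by simp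
      show "\<exists>c. sparse (carrier G) r (right_mult_matrix G s) c" if "s \<in> ?T" for s
        using that all sub by auto
    qed
    then obtain c where c: "sparse (carrier G) r (\<lambda>x y. \<exists>s\<in>?T. right_mult_matrix G s x y) c" ..
    have "\<exists>s\<in>?T. right_mult_matrix G s x y"
      if "x \<in> carrier G" "y \<in> carrier G" "cayley_adj G S x y" for x y
    proof
      show "inv x \<otimes> y \<in> ?T" using that(3) unfolding cayley_adj_def by simp
      show "right_mult_matrix G (inv x \<otimes> y) x y"
        using that(1,2) unfolding right_mult_matrix_def by (simp add: m_assoc[symmetric])
    qed
    with c have "sparse (carrier G) r (cayley_adj G S) c" by (rule sparse_mono)
    then show ?thesis by blast
  qed
qed

lemma right_mult_stww_finite_iff:
  assumes "linear_order_on (carrier G) r" "g \<in> carrier G"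
  shows "right_mult_stww G r g < \<infinity> \<longleftrightarrow> (\<exists>c. sparse (carrier G) r (right_mult_matrix G g) c)"
proof
  assume "right_mult_stww G r g < \<infinity>"
  then show "\<exists>c. sparse (carrier G) r (right_mult_matrix G g) c"
    unfolding right_mult_stww_def by (rule matrix_stww_finite_sparse[OF assms(1)])
next
  assume "\<exists>c. sparse (carrier G) r (right_mult_matrix G g) c"
  then obtain c where c: "sparse (carrier G) r (right_mult_matrix G g) c" ..
  \<comment> \<open>\<open>M_g\<close> is a permutation matrix, so the division into singletons has
    width at most 1.\<close>
  have "card {y \<in> V. right_mult_matrix G g x y} \<le> 1" for x V
  proof -
    have "{y \<in> V. right_mult_matrix G g x y} \<subseteq> {x \<otimes> g}" unfolding right_mult_matrix_def by auto
    from card_mono[OF _ this] show ?thesis by simp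
  qed
  moreover have "card {x \<in> U. right_mult_matrix G g x y} \<le> 1" if "U \<subseteq> carrier G" for y U
  proof -
    have "{x \<in> U. right_mult_matrix G g x y} \<subseteq> {y \<otimes> inv g}"
      using that assms(2) unfolding right_mult_matrix_def by (auto simp: m_assoc subset_iff)
    from card_mono[OF _ this] show ?thesis by simp
  qed
  ultimately show "right_mult_stww G r g < \<infinity>"
    unfolding right_mult_stww_def by (intro sparse_matrix_stww_finite[OF assms(1) c, of 1]) auto
qed

lemma cayley_stww_finite_iff:
  assumes S: "finite_generating_set G S"
  shows "cayley_stww G S < \<infinity> \<longleftrightarrow>
    (\<exists>r. linear_order_on (carrier G) r \<and>
       (\<forall>g\<in>carrier G. \<exists>c. sparse (carrier G) r (right_mult_matrix G g) c))"
    (is "_ \<longleftrightarrow> ?rhs")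
proof
  have sub: "finite S" "S \<subseteq> carrier G" using S unfolding finite_generating_set_def by auto
  show ?rhs if "cayley_stww G S < \<infinity>"
  proof -
    have "\<exists>r c. linear_order_on (carrier G) r \<and> sparse (carrier G) r (cayley_adj G S) c"
      using cayley_adj_sym[OF sub(2)] that[unfolded cayley_stww_def] by (rule graph_stww_finite_sparse)
    then show ?thesis using sparse_cayley_iff[OF _ S] by blast
  qed
  show "cayley_stww G S < \<infinity>" if ?rhs
  proof -
    from that obtain r c
      where "linear_order_on (carrier G) r" "sparse (carrier G) r (cayley_adj G S) c"
      using sparse_cayley_iff[OF _ S] by blast
    then show ?thesis unfolding cayley_stww_def
      by (rule sparse_graph_stww_finite) (rule card_cayley_neighbours[OF sub])
  qed
qed

text \<open>The grid number of a graph minimises over orders, which is the source of the existential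
  quantifier over \<open>r\<close>.\<close>

lemma cayley_grid_number_finite_iff:
  assumes S: "finite_generating_set G S"
  shows "cayley_grid_number G S < \<infinity> \<longleftrightarrow>
    (\<exists>r. linear_order_on (carrier G) r \<and>
       (\<forall>g\<in>carrier G. \<exists>c. sparse (carrier G) r (right_mult_matrix G g) c))"
  unfolding cayley_grid_number_def graph_grid_number_def INF_less_iff
  using grid_number_finite_iff_sparse[of "carrier G" _ "cayley_adj G S"] sparse_cayley_iff[OF _ S]
  by (auto simp del: enat_ord_simps)

lemma right_mult_grid_number_finite_iff:
  assumes "linear_order_on (carrier G) r"
  shows "right_mult_grid_number G r g < \<infinity> \<longleftrightarrow>
    (\<exists>c. sparse (carrier G) r (right_mult_matrix G g) c)"
  unfolding right_mult_grid_number_def by (rule grid_number_finite_iff_sparse[OF assms])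

end

theorem lemma5p1:
  fixes \<Gamma> :: "('a, 'm) monoid_scheme"
  assumes "group \<Gamma>"
    and "\<exists>S. finite_generating_set \<Gamma> S"
  shows "((\<exists>S. finite_generating_set \<Gamma> S \<and> cayley_stww \<Gamma> S < \<infinity>)
            \<longleftrightarrow> (\<forall>S. finite_generating_set \<Gamma> S \<longrightarrow> cayley_stww \<Gamma> S < \<infinity>)) \<and>
         ((\<exists>S. finite_generating_set \<Gamma> S \<and> cayley_stww \<Gamma> S < \<infinity>)
            \<longleftrightarrow> (\<exists>S. finite_generating_set \<Gamma> S \<and> cayley_grid_number \<Gamma> S < \<infinity>)) \<and>
         ((\<exists>S. finite_generating_set \<Gamma> S \<and> cayley_stww \<Gamma> S < \<infinity>)
            \<longleftrightarrow> (\<forall>S. finite_generating_set \<Gamma> S \<longrightarrow> cayley_grid_number \<Gamma> S < \<infinity>)) \<and>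
         ((\<exists>S. finite_generating_set \<Gamma> S \<and> cayley_stww \<Gamma> S < \<infinity>)
            \<longleftrightarrow> (\<exists>r. linear_order_on (carrier \<Gamma>) r \<and>
                     (\<forall>g\<in>carrier \<Gamma>. right_mult_stww \<Gamma> r g < \<infinity>))) \<and>
         ((\<exists>S. finite_generating_set \<Gamma> S \<and> cayley_stww \<Gamma> S < \<infinity>)
            \<longleftrightarrow> (\<exists>r. linear_order_on (carrier \<Gamma>) r \<and>
                     (\<forall>g\<in>carrier \<Gamma>. right_mult_grid_number \<Gamma> r g < \<infinity>)))"
proof -
  interpret group \<Gamma> by (rule assms(1))
  define H where "H \<longleftrightarrow> (\<exists>r. linear_order_on (carrier \<Gamma>) r \<and>
     (\<forall>g\<in>carrier \<Gamma>. \<exists>c. sparse (carrier \<Gamma>) r (right_mult_matrix \<Gamma> g) c))"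
  have cayley: "\<And>S. finite_generating_set \<Gamma> S \<Longrightarrow> cayley_stww \<Gamma> S < \<infinity> \<longleftrightarrow> H"
    "\<And>S. finite_generating_set \<Gamma> S \<Longrightarrow> cayley_grid_number \<Gamma> S < \<infinity> \<longleftrightarrow> H"
    unfolding H_def by (fact cayley_stww_finite_iff, fact cayley_grid_number_finite_iff)
  have "(\<exists>S. finite_generating_set \<Gamma> S \<and> cayley_stww \<Gamma> S < \<infinity>) \<longleftrightarrow> H"
    "(\<forall>S. finite_generating_set \<Gamma> S \<longrightarrow> cayley_stww \<Gamma> S < \<infinity>) \<longleftrightarrow> H"
    "(\<exists>S. finite_generating_set \<Gamma> S \<and> cayley_grid_number \<Gamma> S < \<infinity>) \<longleftrightarrow> H"
    "(\<forall>S. finite_generating_set \<Gamma> S \<longrightarrow> cayley_grid_number \<Gamma> S < \<infinity>) \<longleftrightarrow> H"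
    \<comment> \<open>The existence of a finite generating set keeps the universal clauses from
      holding vacuously.\<close>
    using assms(2) cayley by blast+
  moreover have "(\<exists>r. linear_order_on (carrier \<Gamma>) r \<and>
      (\<forall>g\<in>carrier \<Gamma>. right_mult_stww \<Gamma> r g < \<infinity>)) \<longleftrightarrow> H"
    unfolding H_def using right_mult_stww_finite_iff by blast
  moreover have "(\<exists>r. linear_order_on (carrier \<Gamma>) r \<and>
      (\<forall>g\<in>carrier \<Gamma>. right_mult_grid_number \<Gamma> r g < \<infinity>)) \<longleftrightarrow> H"
    unfolding H_def using right_mult_grid_number_finite_iff by blast
  ultimately show ?thesis by simp
qed

end
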